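(* Let $\{J_B\}$ be an interaction on $\mathbb{Z}^d$ and assume that $$\sup_{i\in\mathbb{Z}^d}\sum_{k\ge 1}|B_i(k)|\Big(\sum_{B:\, i\in B,\ B\subset B_i(k),\ B\not\subset B_i(k-1)}|J_B|\Big)<\infty .$$ Then there exists $\beta_c>0$ such that for every $0<\beta<\beta_c$ and every integer $L\ge1$, the Gibbs measure $\mu$ relative to the interaction $\{\beta J_B\}$ and the Gibbs measure $\mu^{[L]}$ relative to this interaction truncated at range $L$ satisfy $$\bar d(\mu,\mu^{[L]})\le\frac1\gamma\,\sup_{i\in\mathbb{Z}^d}\Big(1-e^{-\beta\sum_{B:\,i\in B,\ B\not\subset B_i(L)}|J_B|}\Big),\qquad \gamma=1-\sup_{i\in\mathbb{Z}^d}\sum_{k\ge1}|B_i(k)|\,\lambda_i(k).$$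
   Context: Setting: $S=\{-1,1\}^{\mathbb{Z}^d}$ with the product sigma-algebra; $\|i\|=\sum_{k=1}^d|i_k|$; $B_i(k)=\{j\in\mathbb{Z}^d:\|j-i\|\le k\}$. An interaction is a family of real numbers $\{J_B\}$ indexed by finite $B\subset\mathbb{Z}^d$ with $|B|\ge2$, satisfying $\sup_i\sum_{B:i\in B}|J_B|<\infty$; all sums over $B$ run over such sets. $\chi_B(\sigma)=\prod_{i\in B}\sigma(i)$. Gibbs measures: $\mu$ is a probability measure on $S$ such that for all $i$ and $\zeta\in S$ a version of $\mu(\sigma(i)=\zeta(i)\mid\sigma(j)=\zeta(j)\ \forall j\ne i)$ is $\big(1+\exp(-2\beta\sum_{B:i\in B}J_B\chi_B(\zeta))\big)^{-1}$. The truncated measure $\mu^{[L]}$ is a probability measure on $S$ for which the corresponding conditional probability is $\big(1+\exp(-2\beta\sum_{B:i\in B,\,B\subset B_i(L)}J_B\chi_B(\zeta))\big)^{-1}$. Constants: $\lambda_i(1)=e^{-\beta\sum_{B:i\in B,\,B\not\subset B_i(1)}|J_B|}-e^{-2\beta\sum_{B:i\in B}|J_B|}$; for $k>1$, $\lambda_i(k)=e^{-\beta\sum_{B:i\in B,\,B\not\subset B_i(k)}|J_B|}-e^{-\beta\sum_{B:i\in B,\,B\not\subset B_i(k-1)}|J_B|}$. Distance: for probability measures $\nu_1,\nu_2$ on $S$, $\bar d(\nu_1,\nu_2)=\inf_{Q}\sup_{i\in\mathbb{Z}^d}Q(\sigma_1(i)\ne\sigma_2(i))$, where the infimum is over all couplings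 $Q$ of $\nu_1$ and $\nu_2$, i.e. probability measures on $S\times S$ with first marginal $\nu_1$ and second marginal $\nu_2$, and $(\sigma_1,\sigma_2)$ denotes a generic element of $S\times S$. *)

theory Defs
  imports "HOL-Probability.Probability"
begin

type_synonym 'd site = "int ^ 'd"
type_synonym 'd config = "'d site \<Rightarrow> real"

definition site_norm :: "'d::finite site \<Rightarrow> int" where
  "site_norm i = (\<Sum>k\<in>UNIV. \<bar>i $ k\<bar>)"

definition site_ball :: "'d::finite site \<Rightarrow> nat \<Rightarrow> 'd site set" where
  "site_ball i k = {j. site_norm (j - i) \<le> int k}"

definition spin_space :: "real measure" where
  "spin_space = count_space {- 1, 1}"

definition config_space :: "'d::finite config measure" where
  "config_space = PiM UNIV (\<lambda>_. spin_space)"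

definition chi :: "'d::finite site set \<Rightarrow> 'd config \<Rightarrow> real" where
  "chi B \<sigma> = (\<Prod>i\<in>B. \<sigma> i)"

text \<open>
  An interaction is a function \<open>J\<close> on all sets of sites; only its values on the finite sets with
  at least two elements are ever used.
\<close>

definition bonds :: "'d::finite site \<Rightarrow> 'd site set set" where
  "bonds i = {B. finite B \<and> 2 \<le> card B \<and> i \<in> B}"

definition bonds_inside :: "'d::finite site \<Rightarrow> nat \<Rightarrow> 'd site set set" where
  "bonds_inside i k = {B \<in> bonds i. B \<subseteq> site_ball i k}"

definition bonds_outside :: "'d::finite site \<Rightarrow> nat \<Rightarrow> 'd site set set" where
  "bonds_outside i k = {B \<in> bonds i. \<not> B \<subseteq> site_ball i k}"

definition interaction :: "('d::finite site set \<Rightarrow> real) \<Rightarrow> bool" where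
  "interaction J \<longleftrightarrow> (SUP i. \<Sum>\<^sub>\<infinity>B\<in>bonds i. ennreal \<bar>J B\<bar>) < \<infinity>"

definition fast_decay :: "('d::finite site set \<Rightarrow> real) \<Rightarrow> bool" where
  "fast_decay J \<longleftrightarrow>
     (SUP i. \<Sum>\<^sub>\<infinity>k\<in>{1..}. of_nat (card (site_ball i k)) *
        (\<Sum>\<^sub>\<infinity>B\<in>bonds_inside i k \<inter> bonds_outside i (k - 1). ennreal \<bar>J B\<bar>)) < \<infinity>"

text \<open>The sigma-algebra on configurations generated by the spins at all sites other than \<open>i\<close>.\<close>

definition off_site_algebra :: "'d::finite site \<Rightarrow> 'd config measure" where
  "off_site_algebra i =
     vimage_algebra (space config_space) (\<lambda>\<sigma>. restrict \<sigma> (- {i})) (PiM (- {i}) (\<lambda>_. spin_space))"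

text \<open>
  \<open>p i \<zeta>\<close> is a version of the conditional probability that the spin at \<open>i\<close> is \<open>\<zeta> i\<close>, given that the
  spins at all other sites are those of \<open>\<zeta>\<close>. The conditioning does not determine \<open>\<zeta> i\<close>: for each
  spin value \<open>a\<close>, the conditional probability of the event \<open>\<sigma> i = a\<close> at \<open>\<sigma>\<close> is \<open>p i\<close> evaluated at
  \<open>\<sigma>\<close> with its spin at \<open>i\<close> replaced by \<open>a\<close>.
\<close>

definition single_site_cond_probs ::
    "('d::finite site \<Rightarrow> 'd config \<Rightarrow> real) \<Rightarrow> 'd config measure \<Rightarrow> bool" where
  "single_site_cond_probs p \<mu> \<longleftrightarrow>
     prob_space \<mu> \<and> sets \<mu> = sets config_space \<and>
     (\<forall>i. \<forall>a\<in>{- 1, 1}. AE \<sigma> in \<mu>.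
        real_cond_exp \<mu> (off_site_algebra i) (indicator {\<eta> \<in> space config_space. \<eta> i = a}) \<sigma>
          = p i (\<sigma>(i := a)))"

definition gibbs_measure ::
    "real \<Rightarrow> ('d::finite site set \<Rightarrow> real) \<Rightarrow> 'd config measure \<Rightarrow> bool" where
  "gibbs_measure \<beta> J =
     single_site_cond_probs
       (\<lambda>i \<zeta>. inverse (1 + exp (- 2 * \<beta> * (\<Sum>\<^sub>\<infinity>B\<in>bonds i. J B * chi B \<zeta>))))"

text \<open>
  The range condition \<open>B \<subseteq> site_ball i L\<close> is relative to the site \<open>i\<close> being resampled, so a bond may
  be kept at one of its sites and dropped at another.
\<close>

definition truncated_gibbs_measure ::
    "real \<Rightarrow> ('d::finite site set \<Rightarrow> real) \<Rightarrow> nat \<Rightarrow> 'd config measure \<Rightarrow> bool" where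
  "truncated_gibbs_measure \<beta> J L =
     single_site_cond_probs
       (\<lambda>i \<zeta>. inverse (1 + exp (- 2 * \<beta> * (\<Sum>\<^sub>\<infinity>B\<in>bonds_inside i L. J B * chi B \<zeta>))))"

definition tail_weight :: "('d::finite site set \<Rightarrow> real) \<Rightarrow> 'd site \<Rightarrow> nat \<Rightarrow> real" where
  "tail_weight J i k = (\<Sum>\<^sub>\<infinity>B\<in>bonds_outside i k. \<bar>J B\<bar>)"

text \<open>Only the values at \<open>k \<ge> 1\<close> are meaningful.\<close>

definition lam :: "real \<Rightarrow> ('d::finite site set \<Rightarrow> real) \<Rightarrow> 'd site \<Rightarrow> nat \<Rightarrow> real" where
  "lam \<beta> J i k =
     (if k = 1 then exp (- \<beta> * tail_weight J i 1) - exp (- 2 * \<beta> * (\<Sum>\<^sub>\<infinity>B\<in>bonds i. \<bar>J B\<bar>))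
      else exp (- \<beta> * tail_weight J i k) - exp (- \<beta> * tail_weight J i (k - 1)))"

definition gam :: "real \<Rightarrow> ('d::finite site set \<Rightarrow> real) \<Rightarrow> real" where
  "gam \<beta> J = 1 - (SUP i. \<Sum>\<^sub>\<infinity>k\<in>{1..}. real (card (site_ball i k)) * lam \<beta> J i k)"

definition couplings ::
    "'d::finite config measure \<Rightarrow> 'd config measure \<Rightarrow> ('d config \<times> 'd config) measure set" where
  "couplings \<nu>1 \<nu>2 =
     {Q. prob_space Q \<and> sets Q = sets (config_space \<Otimes>\<^sub>M config_space) \<and>
         distr Q config_space fst = \<nu>1 \<and> distr Q config_space snd = \<nu>2}"

definition dbar :: "'d::finite config measure \<Rightarrow> 'd config measure \<Rightarrow> real" where
  "dbar \<nu>1 \<nu>2 =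
     (INF Q\<in>couplings \<nu>1 \<nu>2. SUP i. measure Q {\<omega> \<in> space Q. fst \<omega> i \<noteq> snd \<omega> i})"

end

theory Submission
  imports Defs
begin

text \<open>
  The two measures are compared by coupled resampling. Being Gibbs for single-site conditional
  probabilities means being invariant under resampling the spin at any site from them
  (\<open>distr_resample\<close>). Given a coupling of \<open>\<mu>\<close> and the truncated measure, resample the spin at \<open>i\<close>
  in both configurations by comparing one uniform variable with the two conditional probabilities.
  The result is again a coupling; the disagreement probability is unchanged at the other sites, and
  at \<open>i\<close> it becomes the mean distance between the two conditional probabilities
  (\<open>disagreement_couple_resample_same\<close>).

  That distance has two sources. The function \<open>x \<mapsto> 1 / (1 + exp (- x))\<close> has Lipschitz constant \<open>1/4\<close>,
  so truncation costs at most \<open>\<beta> t / 2\<close> with \<open>t\<close> the tail weight at \<open>i\<close>, and a bond \<open>B\<close> costs at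
  most \<open>\<beta> \<bar>J B\<bar>\<close> times the number of its sites at which the configurations disagree. If every site has
  disagreement probability at most \<open>r\<close>, the mean of the second part is at most \<open>\<beta> r\<close> times the sum of
  \<open>\<bar>J B\<bar> \<bar>B\<bar>\<close> over the bonds \<open>B\<close> at \<open>i\<close>. A bond in the \<open>k\<close>-th shell has at most as many sites as the
  ball of radius \<open>k\<close>, so the fast decay condition bounds this sum by a constant \<open>C\<close>
  (\<open>size_weighted_sum_le\<close>). Hence the new disagreement probability at \<open>i\<close> is at most
  \<open>\<beta> C r + sup \<beta> t / 2\<close>.

  The distance takes a supremum over infinitely many sites, so all of them have to be resampled.
  Visiting the sites one after the other changes each spin at most once, so the
  configurations converge coordinatewise and the limit is again a coupling (\<open>sweep_coupling\<close>). A
  sweep applied to a nearly optimal coupling then gives a bound on the distance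
  (\<open>dbar_le_of_contraction\<close>): it is at most \<open>(sup \<beta> t / 2) / (1 - \<beta> C)\<close>.

  For small \<open>\<beta>\<close> this already beats the claim. On the one hand \<open>0 < \<gamma> \<le> 1\<close> (\<open>gam_bounds\<close>), so it
  suffices to bound the distance by \<open>sup (1 - exp (- \<beta> t))\<close>. On the other hand \<open>1 - exp (- x)\<close>
  is close to \<open>x\<close>, not to \<open>x / 2\<close>, for small \<open>x\<close>: one has \<open>x / 2 \<le> 2/3 (1 - exp (- x))\<close> once
  \<open>x \<le> 1/3\<close>, and \<open>\<beta> C \<le> 1/3\<close> makes the factor \<open>1 / (1 - \<beta> C)\<close> at most \<open>3/2\<close>.
\<close>

section \<open>Spin configurations\<close>
lemma space_spin [simp]: "space spin_space = {-1, 1}"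
  and sets_spin [simp]: "sets spin_space = Pow {-1, 1}"
  by (simp_all add: spin_space_def)

lemma space_config: "space config_space = {\<sigma> :: 'd::finite config. \<forall>i. \<sigma> i \<in> {-1, 1}}"
  by (auto simp: config_space_def space_PiM PiE_def)

lemma spin_cases:
  fixes \<sigma> :: "'d::finite config"
  assumes "\<sigma> \<in> space config_space" shows "\<sigma> i = -1 \<or> \<sigma> i = 1"
  using assms by (auto simp: space_config)

lemma measurable_spin [measurable]: "(\<lambda>\<sigma> :: 'd::finite config. \<sigma> i) \<in> config_space \<rightarrow>\<^sub>M spin_space"
  unfolding config_space_def by measurable

lemma spin_space_borel: "f \<in> M \<rightarrow>\<^sub>M spin_space \<Longrightarrow> f \<in> borel_measurable M"
proof -
  have "(\<lambda>x. x) \<in> spin_space \<rightarrow>\<^sub>M (borel :: real measure)" by (simp add: spin_space_def)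
  then show "f \<in> M \<rightarrow>\<^sub>M spin_space \<Longrightarrow> f \<in> borel_measurable M"
    using measurable_compose[of f M spin_space "\<lambda>x. x" borel] by simp
qed

lemma measurable_spin_borel [measurable]:
  "(\<lambda>\<sigma> :: 'd::finite config. \<sigma> i) \<in> borel_measurable config_space"
  by (rule spin_space_borel) measurable

lemma measurable_set_spin [measurable (raw)]:
  fixes \<sigma> :: "'a \<Rightarrow> 'd::finite config"
  assumes [measurable]: "\<sigma> \<in> M \<rightarrow>\<^sub>M config_space" "f \<in> M \<rightarrow>\<^sub>M spin_space"
  shows "(\<lambda>x. (\<sigma> x)(i := f x)) \<in> M \<rightarrow>\<^sub>M config_space"
  unfolding config_space_def
proof (rule measurable_PiM_single')
  show "(\<lambda>x. ((\<sigma> x)(i := f x)) j) \<in> M \<rightarrow>\<^sub>M spin_space" for j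
    by (cases "j = i") simp_all
  show "(\<lambda>x. (\<sigma> x)(i := f x)) \<in> space M \<rightarrow> UNIV \<rightarrow>\<^sub>E space spin_space"
    using measurable_space[OF assms(1)] measurable_space[OF assms(2)]
    by (fastforce simp: space_config)
qed

section \<open>Resampling a single spin\<close>
text \<open>
  The value \<open>p i \<sigma>\<close> is the probability of the spin \<open>\<sigma> i\<close> at \<open>i\<close> given the other spins of \<open>\<sigma>\<close>, so
  the values at \<open>\<sigma>(i := 1)\<close> and \<open>\<sigma>(i := -1)\<close> form a probability distribution on spins.
\<close>
locale single_site_spec =
  fixes p :: "'d::finite site \<Rightarrow> 'd config \<Rightarrow> real"
  assumes meas [measurable]: "p i \<in> borel_measurable config_space"
    and nonneg: "0 \<le> p i \<sigma>"
    and sum_to_one: "p i (\<sigma>(i := 1)) + p i (\<sigma>(i := -1)) = 1"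
begin

lemma up_le_1: "p i (\<sigma>(i := 1)) \<le> 1"
  using sum_to_one[of i \<sigma>] nonneg[of i "\<sigma>(i := -1)"] by linarith

end

lemma emeasure_distr_pair:
  assumes N: "prob_space N" and f: "(\<lambda>(x, u). f x u) \<in> M \<Otimes>\<^sub>M N \<rightarrow>\<^sub>M E" and A: "A \<in> sets E"
  shows "emeasure (distr (M \<Otimes>\<^sub>M N) E (\<lambda>(x, u). f x u)) A =
           (\<integral>\<^sup>+x. \<integral>\<^sup>+u. indicator A (f x u) \<partial>N \<partial>M)"
proof -
  interpret prob_space N by fact
  let ?D = "distr (M \<Otimes>\<^sub>M N) E (\<lambda>(x, u). f x u)"
  have g: "(\<lambda>y. indicator A (case y of (x, u) \<Rightarrow> f x u) :: ennreal) \<in> borel_measurable (M \<Otimes>\<^sub>M N)"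
    by (rule measurable_compose[OF f borel_measurable_indicator[OF A]])
  have "emeasure ?D A = (\<integral>\<^sup>+y. indicator A y \<partial>?D)"
    using A by (intro nn_integral_indicator[symmetric]) simp
  also have "\<dots> = (\<integral>\<^sup>+y. indicator A (case y of (x, u) \<Rightarrow> f x u) \<partial>(M \<Otimes>\<^sub>M N))"
    using A by (intro nn_integral_distr[OF f]) simp
  also have "\<dots> = (\<integral>\<^sup>+x. \<integral>\<^sup>+u. indicator A (f x u) \<partial>N \<partial>M)"
    using nn_integral_fst[OF g] by simp
  finally show ?thesis .
qed

definition unif :: "real measure" where
  "unif = uniform_measure lborel {0..1}"

lemma sets_unif [measurable_cong, simp]: "sets unif = sets borel"
  and space_unif [simp]: "space unif = UNIV"
  by (simp_all add: unif_def)

interpretation unif: prob_space unif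
  unfolding unif_def by (rule prob_space_uniform_measure) auto

lemma emeasure_unif_less:
  assumes "0 \<le> a" "a \<le> 1"
  shows "emeasure unif {u. u < a} = ennreal a"
proof -
  have "{0..1} \<inter> {u. u < a} = {0..<a}" using assms by auto
  then show ?thesis using assms by (simp add: unif_def divide_ennreal_def)
qed

lemma emeasure_unif_between:
  assumes "0 \<le> a" "a \<le> 1" "0 \<le> b" "b \<le> 1"
  shows "emeasure unif {u. (u < a) \<noteq> (u < b)} = ennreal \<bar>a - b\<bar>"
proof -
  have "{0..1} \<inter> {u. (u < a) \<noteq> (u < b)} = {min a b..<max a b}" using assms by auto
  moreover have "max a b - min a b = \<bar>a - b\<bar>" by (simp add: max_def min_def)
  ultimately show ?thesis using assms by (simp add: unif_def divide_ennreal_def)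
qed

lemma nn_integral_unif_threshold:
  fixes f :: "real \<Rightarrow> ennreal"
  assumes a: "0 \<le> a" "a \<le> 1"
  shows "(\<integral>\<^sup>+u. f (if u < a then 1 else -1) \<partial>unif) = ennreal a * f 1 + ennreal (1 - a) * f (-1)"
proof -
  have compl: "emeasure unif {u. \<not> u < a} = ennreal (1 - a)"
  proof -
    have "{0..1} \<inter> {u. \<not> u < a} = {a..1}" using a by auto
    then show ?thesis using a by (simp add: unif_def divide_ennreal_def not_less)
  qed
  have "(\<integral>\<^sup>+u. f (if u < a then 1 else -1) \<partial>unif) =
      (\<integral>\<^sup>+u. f 1 * indicator {u. u < a} u + f (-1) * indicator {u. \<not> u < a} u \<partial>unif)"
    by (intro nn_integral_cong) (auto simp: indicator_def)
  also have "\<dots> = f 1 * emeasure unif {u. u < a} + f (-1) * emeasure unif {u. \<not> u < a}"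
    by (subst nn_integral_add) (auto simp: nn_integral_cmult_indicator)
  finally show ?thesis using a by (simp add: emeasure_unif_less compl mult.commute)
qed

definition resample ::
    "('d::finite site \<Rightarrow> 'd config \<Rightarrow> real) \<Rightarrow> 'd site \<Rightarrow> 'd config \<Rightarrow> real \<Rightarrow> 'd config" where
  "resample p i \<sigma> u = \<sigma>(i := if u < p i (\<sigma>(i := 1)) then 1 else -1)"

lemma (in single_site_spec) measurable_resample [measurable (raw)]:
  assumes [measurable]: "f \<in> M \<rightarrow>\<^sub>M config_space" "g \<in> M \<rightarrow>\<^sub>M unif"
  shows "(\<lambda>x. resample p i (f x) (g x)) \<in> M \<rightarrow>\<^sub>M config_space"
proof -
  have [measurable]: "g \<in> borel_measurable M"
    using assms(2) measurable_cong_sets[OF refl sets_unif] by blast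
  have [simp]: "(\<lambda>x. 1) \<in> M \<rightarrow>\<^sub>M spin_space" "(\<lambda>x. -1) \<in> M \<rightarrow>\<^sub>M spin_space"
    by (auto intro!: measurable_const)
  have [measurable]: "(\<lambda>x. p i ((f x)(i := 1))) \<in> borel_measurable M"
    by (rule measurable_compose[OF _ meas]) (rule measurable_set_spin; simp)
  have "(\<lambda>x. if g x < p i ((f x)(i := 1)) then 1 else -1 :: real) \<in> M \<rightarrow>\<^sub>M spin_space"
    by (rule measurable_If) (simp_all, measurable)
  then show ?thesis
    unfolding resample_def by (rule measurable_set_spin[OF assms(1)])
qed

text \<open>
  Overwriting the spin at \<open>i\<close> by a constant forgets it, so functions of \<open>\<sigma>(i := a)\<close> can be taken
  out of conditional expectations given the spins off \<open>i\<close>.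
\<close>
lemma measurable_set_spin_off_site:
  fixes i :: "'d::finite site"
  assumes a: "a \<in> {-1, 1}"
  shows "(\<lambda>\<sigma>. \<sigma>(i := a)) \<in> off_site_algebra i \<rightarrow>\<^sub>M config_space"
proof -
  have r: "(\<lambda>\<sigma>. restrict \<sigma> (- {i})) \<in> off_site_algebra i \<rightarrow>\<^sub>M PiM (- {i}) (\<lambda>_. spin_space)"
    unfolding off_site_algebra_def
    by (rule measurable_vimage_algebra1) (auto simp: space_config space_PiM)
  have ins: "insert i (- {i}) = UNIV" by auto
  have "(\<lambda>\<sigma>. (restrict \<sigma> (- {i}))(i := a)) \<in> off_site_algebra i \<rightarrow>\<^sub>M config_space"
    using measurable_compose[OF measurable_Pair[OF r measurable_const[of a spin_space]]
        measurable_add_dim[of i "- {i}" "\<lambda>_. spin_space"]] a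
    by (simp add: config_space_def ins case_prod_beta)
  moreover have "(\<lambda>\<sigma>. (restrict \<sigma> (- {i}))(i := a)) = (\<lambda>\<sigma> :: 'd config. \<sigma>(i := a))"
    by (auto simp: fun_eq_iff)
  ultimately show ?thesis by simp
qed

lemma subalgebra_off_site:
  assumes "sets \<mu> = sets config_space"
  shows "subalgebra \<mu> (off_site_algebra i)"
proof -
  have "space \<mu> = space config_space" using assms by (rule sets_eq_imp_space_eq)
  moreover have "(\<lambda>\<sigma>. restrict \<sigma> (- {i})) \<in> config_space \<rightarrow>\<^sub>M PiM (- {i}) (\<lambda>_. spin_space)"
    unfolding config_space_def by (rule measurable_restrict_subset) simp
  ultimately show ?thesis
    unfolding subalgebra_def off_site_algebra_def assms
    using sets_image_in_sets[of config_space "space config_space"] by (metis space_vimage_algebra)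
qed

context single_site_spec
begin

text \<open>
  The indicator of \<open>A\<close> at \<open>\<sigma>(i := a)\<close> is measurable with respect to the conditioning, so the
  conditional probability that it multiplies may be replaced by the indicator of \<open>\<sigma> i = a\<close>.
\<close>
lemma nn_integral_cond_prob:
  assumes \<mu>: "single_site_cond_probs p \<mu>" and a: "a \<in> {-1, 1}" and A: "A \<in> sets config_space"
  shows "(\<integral>\<^sup>+\<sigma>. ennreal (p i (\<sigma>(i := a))) * indicator A (\<sigma>(i := a)) \<partial>\<mu>) =
           emeasure \<mu> {\<sigma> \<in> A. \<sigma> i = a}"
proof -
  have sets [measurable_cong, simp]: "sets \<mu> = sets config_space"
    and ce: "AE \<sigma> in \<mu>. real_cond_exp \<mu> (off_site_algebra i)
               (indicator {\<eta> \<in> space config_space. \<eta> i = a}) \<sigma> = p i (\<sigma>(i := a))"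
    using \<mu> a unfolding single_site_cond_probs_def by auto
  interpret prob_space \<mu> using \<mu> by (simp add: single_site_cond_probs_def)
  interpret finite_measure_subalgebra \<mu> "off_site_algebra i"
    by unfold_locales (rule subalgebra_off_site[OF sets])
  have sp: "space \<mu> = space config_space" by (rule sets_eq_imp_space_eq[OF sets])
  let ?g = "indicator {\<eta> \<in> space config_space. \<eta> i = a} :: _ \<Rightarrow> real"
  let ?f = "\<lambda>\<sigma>. indicator A (\<sigma>(i := a)) :: real"
  have f: "?f \<in> borel_measurable (off_site_algebra i)"
    using measurable_compose[OF measurable_set_spin_off_site[OF a] borel_measurable_indicator[OF A]] .
  have f' [measurable]: "?f \<in> borel_measurable \<mu>"
    using measurable_from_subalg[OF subalg f] .
  have E: "{\<eta> \<in> space config_space. \<eta> i = a} \<in> sets config_space" by measurable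
  have g [measurable]: "?g \<in> borel_measurable \<mu>" using E by simp
  have int: "integrable \<mu> (\<lambda>\<sigma>. ?f \<sigma> * ?g \<sigma>)"
    by (rule integrable_const_bound[where B = 1]; (measurable)?) (auto simp: indicator_def)
  note ci = real_cond_exp_intg[OF int f g]
  have "(\<integral>\<^sup>+\<sigma>. ennreal (p i (\<sigma>(i := a))) * indicator A (\<sigma>(i := a)) \<partial>\<mu>) =
      (\<integral>\<^sup>+\<sigma>. ennreal (?f \<sigma> * real_cond_exp \<mu> (off_site_algebra i) ?g \<sigma>) \<partial>\<mu>)"
    using ce by (intro nn_integral_cong_AE) (auto simp: indicator_def)
  also have "\<dots> = ennreal (\<integral>\<sigma>. ?f \<sigma> * real_cond_exp \<mu> (off_site_algebra i) ?g \<sigma> \<partial>\<mu>)"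
    using ce by (intro nn_integral_eq_integral ci(1)) (auto simp: indicator_def nonneg)
  also have "\<dots> = ennreal (\<integral>\<sigma>. ?f \<sigma> * ?g \<sigma> \<partial>\<mu>)" using ci(2) by simp
  also have "\<dots> = (\<integral>\<^sup>+\<sigma>. ennreal (?f \<sigma> * ?g \<sigma>) \<partial>\<mu>)"
    by (intro nn_integral_eq_integral[symmetric] int) auto
  also have "\<dots> = (\<integral>\<^sup>+\<sigma>. indicator {\<sigma> \<in> A. \<sigma> i = a} \<sigma> \<partial>\<mu>)"
    using sets.sets_into_space[OF A]
    by (intro nn_integral_cong) (auto simp: indicator_def sp)
  also have "\<dots> = emeasure \<mu> {\<sigma> \<in> A. \<sigma> i = a}"
  proof (rule nn_integral_indicator)
    have "{\<sigma> \<in> A. \<sigma> i = a} = A \<inter> {\<eta> \<in> space config_space. \<eta> i = a}"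
      using sets.sets_into_space[OF A] by auto
    then show "{\<sigma> \<in> A. \<sigma> i = a} \<in> sets \<mu>" using A E by simp
  qed
  finally show ?thesis .
qed

text \<open>
  Averaging over the uniform variable puts weight \<open>p i (\<sigma>(i := a))\<close> on \<open>\<sigma>(i := a)\<close>; by
  \<open>nn_integral_cond_prob\<close> the two values of \<open>a\<close> contribute the mass of \<open>A\<close> on \<open>\<sigma> i = 1\<close> and on
  \<open>\<sigma> i = -1\<close>.
\<close>
lemma distr_resample:
  assumes \<mu>: "single_site_cond_probs p \<mu>"
  shows "distr (\<mu> \<Otimes>\<^sub>M unif) config_space (\<lambda>(\<sigma>, u). resample p i \<sigma> u) = \<mu>"
proof (rule measure_eqI)
  have sets [measurable_cong, simp]: "sets \<mu> = sets config_space"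
    using \<mu> unfolding single_site_cond_probs_def by auto
  have sp: "space \<mu> = space config_space" by (rule sets_eq_imp_space_eq[OF sets])
  interpret prob_space \<mu> using \<mu> by (simp add: single_site_cond_probs_def)
  interpret P: pair_prob_space \<mu> unif ..
  show "sets (distr (\<mu> \<Otimes>\<^sub>M unif) config_space (\<lambda>(\<sigma>, u). resample p i \<sigma> u)) = sets \<mu>" by simp
  fix A assume "A \<in> sets (distr (\<mu> \<Otimes>\<^sub>M unif) config_space (\<lambda>(\<sigma>, u). resample p i \<sigma> u))"
  then have A [measurable]: "A \<in> sets config_space" by simp
  have R: "(\<lambda>(\<sigma>, u). resample p i \<sigma> u) \<in> \<mu> \<Otimes>\<^sub>M unif \<rightarrow>\<^sub>M config_space" by measurable
  have m1 [measurable]: "(\<lambda>\<sigma>. \<sigma>(i := a)) \<in> \<mu> \<rightarrow>\<^sub>M config_space" if "a \<in> {-1, 1}" for a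
    using that by (intro measurable_set_spin) (auto intro!: measurable_const)
  have m [measurable]: "(\<lambda>\<sigma>. ennreal (p i (\<sigma>(i := a))) * indicator A (\<sigma>(i := a))) \<in> borel_measurable \<mu>"
    if "a \<in> {-1, 1}" for a
    using measurable_compose[OF m1[OF that] meas] measurable_compose[OF m1[OF that], of "indicator A"]
    by measurable
  have "emeasure (distr (\<mu> \<Otimes>\<^sub>M unif) config_space (\<lambda>(\<sigma>, u). resample p i \<sigma> u)) A =
      (\<integral>\<^sup>+\<sigma>. \<integral>\<^sup>+u. indicator A (resample p i \<sigma> u) \<partial>unif \<partial>\<mu>)"
    by (rule emeasure_distr_pair[OF unif.prob_space_axioms R A])
  also have "\<dots> = (\<integral>\<^sup>+\<sigma>. ennreal (p i (\<sigma>(i := 1))) * indicator A (\<sigma>(i := 1))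
                      + ennreal (p i (\<sigma>(i := -1))) * indicator A (\<sigma>(i := -1)) \<partial>\<mu>)"
  proof (rule nn_integral_cong)
    fix \<sigma>
    have "p i (\<sigma>(i := -1)) = 1 - p i (\<sigma>(i := 1))" using sum_to_one[of i \<sigma>] by simp
    then show "(\<integral>\<^sup>+u. indicator A (resample p i \<sigma> u) \<partial>unif) =
        ennreal (p i (\<sigma>(i := 1))) * indicator A (\<sigma>(i := 1))
                      + ennreal (p i (\<sigma>(i := -1))) * indicator A (\<sigma>(i := -1))"
      unfolding resample_def
      using nn_integral_unif_threshold[OF nonneg up_le_1, where f = "\<lambda>s. indicator A (\<sigma>(i := s))"]
      by simp
  qed
  also have "\<dots> = emeasure \<mu> {\<sigma> \<in> A. \<sigma> i = 1} + emeasure \<mu> {\<sigma> \<in> A. \<sigma> i = -1}"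
    using nn_integral_cond_prob[OF \<mu> _ A] by (subst nn_integral_add) (simp_all add: m)
  also have "\<dots> = emeasure \<mu> ({\<sigma> \<in> A. \<sigma> i = 1} \<union> {\<sigma> \<in> A. \<sigma> i = -1})"
  proof (rule plus_emeasure)
    have "{\<sigma> \<in> A. \<sigma> i = a} = A \<inter> {\<eta> \<in> space config_space. \<eta> i = a}" for a
      using sets.sets_into_space[OF A] by auto
    then show "{\<sigma> \<in> A. \<sigma> i = 1} \<in> sets \<mu>" "{\<sigma> \<in> A. \<sigma> i = -1} \<in> sets \<mu>" by simp_all
  qed auto
  also have "{\<sigma> \<in> A. \<sigma> i = 1} \<union> {\<sigma> \<in> A. \<sigma> i = -1} = A"
    using sets.sets_into_space[OF A] by (auto dest!: spin_cases[of _ i])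
  finally show "emeasure (distr (\<mu> \<Otimes>\<^sub>M unif) config_space (\<lambda>(\<sigma>, u). resample p i \<sigma> u)) A
    = emeasure \<mu> A" .
qed

end

section \<open>Resampling both components of a coupling\<close>
text \<open>
  Both components use the same \<open>u\<close>. This couples the two new spins optimally: they
  differ exactly when \<open>u\<close> falls between the two probabilities of spin \<open>1\<close>.
\<close>
definition couple_resample ::
    "('d::finite site \<Rightarrow> 'd config \<Rightarrow> real) \<Rightarrow> ('d site \<Rightarrow> 'd config \<Rightarrow> real) \<Rightarrow> 'd site \<Rightarrow>
      'd config \<times> 'd config \<Rightarrow> real \<Rightarrow> 'd config \<times> 'd config" where
  "couple_resample p q i \<omega> u = (resample p i (fst \<omega>) u, resample q i (snd \<omega>) u)"

definition disagreement :: "('d::finite config \<times> 'd config) measure \<Rightarrow> 'd site \<Rightarrow> real" where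
  "disagreement Q i = measure Q {\<omega> \<in> space Q. fst \<omega> i \<noteq> snd \<omega> i}"

lemma pred_disagree [measurable]:
  fixes i :: "'d::finite site"
  shows "Measurable.pred (config_space \<Otimes>\<^sub>M config_space) (\<lambda>\<omega>. fst \<omega> i \<noteq> snd \<omega> i)"
proof -
  have [measurable]: "(\<lambda>\<omega>. fst \<omega> i) \<in> borel_measurable (config_space \<Otimes>\<^sub>M config_space)"
    "(\<lambda>\<omega>. snd \<omega> i) \<in> borel_measurable (config_space \<Otimes>\<^sub>M config_space)"
    by (auto intro: measurable_compose[OF measurable_fst measurable_spin_borel]
                    measurable_compose[OF measurable_snd measurable_spin_borel])
  show ?thesis by measurable
qed

text \<open>
  The invariance of \<open>\<mu>\<close> only concerns the law of the resampled configuration, so it holds for every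
  random configuration \<open>f\<close> with law \<open>\<mu>\<close>; it is applied to the two components of a coupling.
\<close>
lemma distr_resample_lifted:
  fixes p :: "'d::finite site \<Rightarrow> 'd config \<Rightarrow> real"
  assumes p: "single_site_spec p" "single_site_cond_probs p \<mu>"
    and Q: "prob_space Q" and f [measurable]: "f \<in> Q \<rightarrow>\<^sub>M config_space" and d: "distr Q config_space f = \<mu>"
  shows "distr (Q \<Otimes>\<^sub>M unif) config_space (\<lambda>(\<omega>, u). resample p i (f \<omega>) u) = \<mu>"
proof -
  interpret single_site_spec p by fact
  interpret Q: prob_space Q by fact
  have sets [measurable_cong]: "sets \<mu> = sets config_space" using d by auto
  have id: "distr unif unif (\<lambda>u. u) = unif" by (rule distr_id)
  have "\<mu> \<Otimes>\<^sub>M unif = distr (Q \<Otimes>\<^sub>M unif) (config_space \<Otimes>\<^sub>M unif) (\<lambda>(\<omega>, u). (f \<omega>, u))"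
    using pair_measure_distr[OF f measurable_ident, of unif] unif.sigma_finite_measure_axioms
    by (simp add: d id distr_id2 id_def)
  then have "\<mu> = distr (distr (Q \<Otimes>\<^sub>M unif) (config_space \<Otimes>\<^sub>M unif) (\<lambda>(\<omega>, u). (f \<omega>, u)))
                   config_space (\<lambda>(\<sigma>, u). resample p i \<sigma> u)"
    using distr_resample[OF p(2), of i] by simp
  also have "\<dots> = distr (Q \<Otimes>\<^sub>M unif) config_space (\<lambda>(\<omega>, u). resample p i (f \<omega>) u)"
    by (subst distr_distr) (auto simp: comp_def case_prod_unfold)
  finally show ?thesis by simp
qed

lemma measurable_couple_resample [measurable]:
  fixes p q :: "'d::finite site \<Rightarrow> 'd config \<Rightarrow> real"
  assumes "single_site_spec p" "single_site_spec q"
  shows "(\<lambda>(\<omega>, u). couple_resample p q i \<omega> u) \<in>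
     (config_space \<Otimes>\<^sub>M config_space) \<Otimes>\<^sub>M unif \<rightarrow>\<^sub>M config_space \<Otimes>\<^sub>M config_space"
proof -
  interpret p: single_site_spec p by fact
  interpret q: single_site_spec q by fact
  show ?thesis unfolding couple_resample_def by measurable
qed

lemma couplingsD:
  assumes "Q \<in> couplings \<mu> \<nu>"
  shows "prob_space Q" "sets Q = sets (config_space \<Otimes>\<^sub>M config_space)"
    "space Q = space (config_space \<Otimes>\<^sub>M config_space)"
    "distr Q config_space fst = \<mu>" "distr Q config_space snd = \<nu>"
  using assms sets_eq_imp_space_eq by (auto simp: couplings_def)

lemma coupling_couple_resample:
  assumes p: "single_site_spec p" "single_site_cond_probs p \<mu>"
    and q: "single_site_spec q" "single_site_cond_probs q \<nu>"
    and Q: "Q \<in> couplings \<mu> \<nu>"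
  shows "distr (Q \<Otimes>\<^sub>M unif) (config_space \<Otimes>\<^sub>M config_space) (\<lambda>(\<omega>, u). couple_resample p q i \<omega> u)
           \<in> couplings \<mu> \<nu>"
proof -
  note Q' = couplingsD[OF Q]
  interpret Q: prob_space Q by (rule Q'(1))
  interpret P: pair_prob_space Q unif ..
  note [measurable_cong] = Q'(2)
  note [measurable] = measurable_couple_resample[OF p(1) q(1)]
  have f: "fst \<in> Q \<rightarrow>\<^sub>M config_space" and s: "snd \<in> Q \<rightarrow>\<^sub>M config_space" by measurable
  show ?thesis
    unfolding couplings_def
    using distr_resample_lifted[OF p Q'(1) f Q'(4), of i] distr_resample_lifted[OF q Q'(1) s Q'(5), of i]
    by (auto intro!: P.prob_space_distr simp: distr_distr comp_def case_prod_unfold)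
       (auto simp: couple_resample_def)
qed

lemma disagreement_couple_resample_same:
  assumes p: "single_site_spec p" and q: "single_site_spec q" and Q: "Q \<in> couplings \<mu> \<nu>"
    and bound: "(\<integral>\<^sup>+\<omega>. ennreal \<bar>p i ((fst \<omega>)(i := 1)) - q i ((snd \<omega>)(i := 1))\<bar> \<partial>Q) \<le> ennreal e" "0 \<le> e"
  shows "disagreement (distr (Q \<Otimes>\<^sub>M unif) (config_space \<Otimes>\<^sub>M config_space)
           (\<lambda>(\<omega>, u). couple_resample p q i \<omega> u)) i \<le> e"
proof -
  note Q' = couplingsD[OF Q]
  interpret p: single_site_spec p by fact
  interpret q: single_site_spec q by fact
  interpret Q: prob_space Q by (rule Q'(1))
  interpret P: pair_prob_space Q unif ..
  note [measurable_cong] = Q'(2)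
  note [measurable] = measurable_couple_resample[OF p q]
  let ?E = "config_space \<Otimes>\<^sub>M config_space :: ('a config \<times> 'a config) measure"
  let ?D = "distr (Q \<Otimes>\<^sub>M unif) ?E (\<lambda>(\<omega>, u). couple_resample p q i \<omega> u)"
  let ?A = "{\<omega> \<in> space ?E. fst \<omega> i \<noteq> snd \<omega> i}"
  have A [measurable]: "?A \<in> sets ?E" by measurable
  have R: "(\<lambda>(\<omega>, u). couple_resample p q i \<omega> u) \<in> Q \<Otimes>\<^sub>M unif \<rightarrow>\<^sub>M ?E" by measurable
  interpret D: prob_space ?D by (rule P.prob_space_distr) fact
  have "emeasure ?D ?A = (\<integral>\<^sup>+\<omega>. \<integral>\<^sup>+u. indicator ?A (couple_resample p q i \<omega> u) \<partial>unif \<partial>Q)"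
    by (rule emeasure_distr_pair[OF unif.prob_space_axioms R A])
  also have "\<dots> = (\<integral>\<^sup>+\<omega>. ennreal \<bar>p i ((fst \<omega>)(i := 1)) - q i ((snd \<omega>)(i := 1))\<bar> \<partial>Q)"
  proof (rule nn_integral_cong)
    fix \<omega> assume "\<omega> \<in> space Q"
    then have sp: "couple_resample p q i \<omega> u \<in> space ?E" for u
      using measurable_space[OF R, of "(\<omega>, u)"] by (simp add: space_pair_measure)
    let ?a = "p i ((fst \<omega>)(i := 1))" and ?b = "q i ((snd \<omega>)(i := 1))"
    have "(\<integral>\<^sup>+u. indicator ?A (couple_resample p q i \<omega> u) \<partial>unif) =
        (\<integral>\<^sup>+u. indicator {u. (u < ?a) \<noteq> (u < ?b)} u \<partial>unif)"
      using sp by (intro nn_integral_cong) (auto simp: indicator_def couple_resample_def resample_def)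
    also have "\<dots> = emeasure unif {u. (u < ?a) \<noteq> (u < ?b)}"
      by (rule nn_integral_indicator) measurable
    also have "\<dots> = ennreal \<bar>?a - ?b\<bar>"
      by (rule emeasure_unif_between) (rule p.nonneg p.up_le_1 q.nonneg q.up_le_1)+
    finally show "(\<integral>\<^sup>+u. indicator ?A (couple_resample p q i \<omega> u) \<partial>unif) = ennreal \<bar>?a - ?b\<bar>" .
  qed
  also have "\<dots> \<le> ennreal e" by fact
  finally show ?thesis
    unfolding disagreement_def using \<open>0 \<le> e\<close> by (simp add: D.emeasure_eq_measure)
qed

lemma disagreement_couple_resample_other:
  assumes p: "single_site_spec p" and q: "single_site_spec q" and Q: "Q \<in> couplings \<mu> \<nu>"
    and ji: "j \<noteq> i"
  shows "disagreement (distr (Q \<Otimes>\<^sub>M unif) (config_space \<Otimes>\<^sub>M config_space)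
           (\<lambda>(\<omega>, u). couple_resample p q i \<omega> u)) j = disagreement Q j"
proof -
  note Q' = couplingsD[OF Q]
  interpret Q: prob_space Q by (rule Q'(1))
  interpret P: pair_prob_space Q unif ..
  note [measurable_cong] = Q'(2)
  note [measurable] = measurable_couple_resample[OF p q]
  let ?E = "config_space \<Otimes>\<^sub>M config_space :: ('a config \<times> 'a config) measure"
  let ?D = "distr (Q \<Otimes>\<^sub>M unif) ?E (\<lambda>(\<omega>, u). couple_resample p q i \<omega> u)"
  have R: "(\<lambda>(\<omega>, u). couple_resample p q i \<omega> u) \<in> Q \<Otimes>\<^sub>M unif \<rightarrow>\<^sub>M ?E" by measurable
  have A: "{\<omega> \<in> space ?E. fst \<omega> j \<noteq> snd \<omega> j} \<in> sets ?E" by measurable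
  have eq: "(\<lambda>(\<omega>, u). couple_resample p q i \<omega> u) -` {\<omega> \<in> space ?E. fst \<omega> j \<noteq> snd \<omega> j} \<inter> space (Q \<Otimes>\<^sub>M unif)
          = {\<omega> \<in> space Q. fst \<omega> j \<noteq> snd \<omega> j} \<times> space unif"
    using measurable_space[OF R] ji
    by (fastforce simp: space_pair_measure couple_resample_def resample_def)
  have "disagreement ?D j = measure (Q \<Otimes>\<^sub>M unif) ({\<omega> \<in> space Q. fst \<omega> j \<noteq> snd \<omega> j} \<times> space unif)"
    unfolding disagreement_def by (simp only: space_distr measure_distr[OF R A] eq)
  also have "\<dots> = disagreement Q j"
    unfolding disagreement_def measure_def using A Q'(2,3) unif.emeasure_space_1
    by (subst unif.emeasure_pair_measure_Times) (simp_all del: space_unif sets_unif)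
  finally show ?thesis .
qed

section \<open>Sweeping over all sites\<close>
primrec iterate_steps :: "(nat \<Rightarrow> 'a \<Rightarrow> real \<Rightarrow> 'a) \<Rightarrow> nat \<Rightarrow> 'a \<Rightarrow> (nat \<Rightarrow> real) \<Rightarrow> 'a" where
  "iterate_steps step 0 x u = x"
| "iterate_steps step (Suc n) x u = step n (iterate_steps step n x u) (u n)"

text \<open>
  The first \<open>n\<close> steps do not look at the later noise, which makes the noise \<open>u n\<close> of
  the next step independent of their outcome.
\<close>
lemma iterate_steps_update_later:
  "n \<le> m \<Longrightarrow> iterate_steps step n x (u(m := v)) = iterate_steps step n x u"
  by (induction n) auto

abbreviation unif_seq :: "(nat \<Rightarrow> real) measure" where
  "unif_seq \<equiv> PiM UNIV (\<lambda>_. unif)"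

interpretation unif_seq: prob_space unif_seq
  by (rule prob_space_PiM) (rule unif.prob_space_axioms)

lemma measurable_iterate_steps [measurable]:
  assumes step: "\<And>n. (\<lambda>(x, u). step n x u) \<in> E \<Otimes>\<^sub>M unif \<rightarrow>\<^sub>M E"
  shows "(\<lambda>(x, u). iterate_steps step n x u) \<in> E \<Otimes>\<^sub>M unif_seq \<rightarrow>\<^sub>M E"
proof (induction n)
  case 0
  then show ?case by simp
next
  case (Suc n)
  have "(\<lambda>x. (case x of (x, u) \<Rightarrow> iterate_steps step n x u, snd x n)) \<in> E \<Otimes>\<^sub>M unif_seq \<rightarrow>\<^sub>M E \<Otimes>\<^sub>M unif"
    by (rule measurable_Pair[OF Suc.IH]) measurable
  from measurable_compose[OF this step[of n]] show ?case
    by (simp add: case_prod_beta)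
qed

text \<open>
  The laws of the iterates form a Markov chain: running \<open>n + 1\<close> steps on a single noise sequence has
  the same law as applying one step with fresh noise to the law after \<open>n\<close> steps.
\<close>
lemma distr_iterate_steps_Suc:
  assumes step: "\<And>n. (\<lambda>(x, u). step n x u) \<in> E \<Otimes>\<^sub>M unif \<rightarrow>\<^sub>M E"
    and Q: "prob_space Q" "sets Q = sets E"
  shows "distr (Q \<Otimes>\<^sub>M unif_seq) E (\<lambda>(x, u). iterate_steps step (Suc n) x u) =
    distr (distr (Q \<Otimes>\<^sub>M unif_seq) E (\<lambda>(x, u). iterate_steps step n x u) \<Otimes>\<^sub>M unif) E (\<lambda>(x, u). step n x u)"
    (is "?L = distr (?law \<Otimes>\<^sub>M unif) E _")
proof (rule measure_eqI)
  interpret Q: prob_space Q by (rule Q(1))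
  interpret P: pair_prob_space Q unif_seq ..
  interpret US: pair_prob_space unif unif_seq ..
  note [measurable_cong] = Q(2)
  note it [measurable] = measurable_iterate_steps[where step = step and E = E, OF step]
  note [measurable] = step
  have law: "prob_space ?law" by (rule P.prob_space_distr) measurable
  interpret law: prob_space ?law by (rule law)
  interpret LU: pair_prob_space ?law unif ..
  show "sets ?L = sets (distr (?law \<Otimes>\<^sub>M unif) E (\<lambda>(x, u). step n x u))" by simp
  fix A assume "A \<in> sets ?L"
  then have A [measurable]: "A \<in> sets E" by simp
  let ?it = "iterate_steps step"
  \<comment> \<open>Overwriting the \<open>n\<close>-th noise by an independent copy does not change the law of the sequence.
    As the first \<open>n\<close> steps ignore that coordinate, the copy then integrates out separately.\<close>
  have fresh: "distr (unif \<Otimes>\<^sub>M unif_seq) unif_seq (\<lambda>(v, u). u(n := v)) = unif_seq"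
    using distr_pair_PiM_eq_PiM[where I = UNIV and M = "\<lambda>_. unif" and i' = n] unif.prob_space_axioms by simp
  have upd: "(\<lambda>(v, u). u(n := v)) \<in> unif \<Otimes>\<^sub>M unif_seq \<rightarrow>\<^sub>M unif_seq"
    using measurable_compose[OF measurable_pair_swap' measurable_add_dim[where i = n and I = UNIV and M = "\<lambda>_. unif"]]
    by (simp add: case_prod_beta)
  have g: "(\<lambda>u. indicator A (step n (?it n x u) (u n)) :: ennreal) \<in> borel_measurable unif_seq"
    if x: "x \<in> space Q" for x
  proof -
    have "x \<in> space E" using x Q(2) sets_eq_imp_space_eq by blast
    from measurable_compose[OF measurable_Pair1'[OF this, of unif_seq] it[of "Suc n"]]
    have "(\<lambda>u. ?it (Suc n) x u) \<in> unif_seq \<rightarrow>\<^sub>M E" by simp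
    from measurable_compose[OF this borel_measurable_indicator[OF A]] show ?thesis by simp
  qed
  have h: "(\<lambda>(v, u). indicator A (step n (?it n x u) v) :: ennreal) \<in> borel_measurable (unif \<Otimes>\<^sub>M unif_seq)"
    if x: "x \<in> space Q" for x
  proof -
    have x': "x \<in> space E" using x Q(2) sets_eq_imp_space_eq by blast
    from measurable_compose[OF measurable_Pair1'[OF this, of unif_seq] it[of n]]
    have "(\<lambda>u. ?it n x u) \<in> unif_seq \<rightarrow>\<^sub>M E" by simp
    then have "(\<lambda>vu. (?it n x (snd vu), fst vu)) \<in> unif \<Otimes>\<^sub>M unif_seq \<rightarrow>\<^sub>M E \<Otimes>\<^sub>M unif"
      by measurable
    from measurable_compose[OF measurable_compose[OF this step[of n]] borel_measurable_indicator[OF A]]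
    show ?thesis by (subst case_prod_unfold) simp
  qed
  have itQ: "(\<lambda>(x, u). ?it m x u) \<in> Q \<Otimes>\<^sub>M unif_seq \<rightarrow>\<^sub>M E" for m by measurable
  let ?inner = "\<lambda>y. \<integral>\<^sup>+v. indicator A (step n y v) \<partial>unif"
  have inner: "?inner \<in> borel_measurable E"
    using unif.borel_measurable_nn_integral_fst[OF measurable_compose[OF step borel_measurable_indicator[OF A]], of n]
    by simp
  have "emeasure ?L A = (\<integral>\<^sup>+x. \<integral>\<^sup>+u. indicator A (?it (Suc n) x u) \<partial>unif_seq \<partial>Q)"
    by (rule emeasure_distr_pair[OF unif_seq.prob_space_axioms itQ A])
  also have "\<dots> = (\<integral>\<^sup>+x. \<integral>\<^sup>+u. \<integral>\<^sup>+v. indicator A (step n (?it n x u) v) \<partial>unif \<partial>unif_seq \<partial>Q)"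
  proof (rule nn_integral_cong)
    fix x assume x: "x \<in> space Q"
    have "(\<integral>\<^sup>+u. indicator A (?it (Suc n) x u) \<partial>unif_seq) =
        (\<integral>\<^sup>+u. indicator A (step n (?it n x u) (u n)) \<partial>distr (unif \<Otimes>\<^sub>M unif_seq) unif_seq (\<lambda>(v, u). u(n := v)))"
      by (simp only: fresh iterate_steps.simps)
    also have "\<dots> = (\<integral>\<^sup>+(v, u). indicator A (step n (?it n x u) v) \<partial>(unif \<Otimes>\<^sub>M unif_seq))"
      using g[OF x] by (subst nn_integral_distr[OF upd])
         (simp_all add: iterate_steps_update_later case_prod_unfold)
    also have "\<dots> = (\<integral>\<^sup>+u. \<integral>\<^sup>+v. indicator A (step n (?it n x u) v) \<partial>unif \<partial>unif_seq)"
      using US.nn_integral_snd[OF h[OF x]] by simp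
    finally show "(\<integral>\<^sup>+u. indicator A (?it (Suc n) x u) \<partial>unif_seq) =
       (\<integral>\<^sup>+u. \<integral>\<^sup>+v. indicator A (step n (?it n x u) v) \<partial>unif \<partial>unif_seq)"
      by simp
  qed
  also have "\<dots> = (\<integral>\<^sup>+z. ?inner (case z of (x, u) \<Rightarrow> ?it n x u) \<partial>(Q \<Otimes>\<^sub>M unif_seq))"
    using unif_seq.nn_integral_fst[OF measurable_compose[OF itQ inner], of n] by simp
  also have "\<dots> = (\<integral>\<^sup>+y. ?inner y \<partial>?law)"
    using inner by (intro nn_integral_distr[OF itQ, symmetric]) simp
  also have "\<dots> = emeasure (distr (?law \<Otimes>\<^sub>M unif) E (\<lambda>(x, u). step n x u)) A"
    by (rule emeasure_distr_pair[OF unif.prob_space_axioms _ A, symmetric]) measurable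
  finally show "emeasure ?L A = emeasure (distr (?law \<Otimes>\<^sub>M unif) E (\<lambda>(x, u). step n x u)) A" .
qed

text \<open>
  A cylinder event depends on finitely many coordinates, for which \<open>f\<close> coincides with \<open>g n\<close> once \<open>n\<close>
  is large. So \<open>f\<close> and the \<open>g n\<close> give it the same probability, and cylinders determine the law.
\<close>
lemma distr_eventually_constant_coordinates:
  fixes f :: "'a \<Rightarrow> 'd::finite config" and g :: "nat \<Rightarrow> 'a \<Rightarrow> 'd config"
  assumes g: "\<And>n. g n \<in> P \<rightarrow>\<^sub>M config_space" and law: "\<And>n. distr P config_space (g n) = \<mu>"
    and P: "prob_space P"
    and eq: "\<And>n j x. x \<in> space P \<Longrightarrow> to_nat j < n \<Longrightarrow> g n x j = f x j"
  shows "f \<in> P \<rightarrow>\<^sub>M config_space" "distr P config_space f = \<mu>"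
proof -
  interpret prob_space P by fact
  show f: "f \<in> P \<rightarrow>\<^sub>M config_space"
    unfolding config_space_def
  proof (rule measurable_PiM_single')
    fix j
    have "(\<lambda>x. g (Suc (to_nat j)) x j) \<in> P \<rightarrow>\<^sub>M spin_space"
      by (rule measurable_compose[OF g measurable_spin])
    then show "(\<lambda>x. f x j) \<in> P \<rightarrow>\<^sub>M spin_space"
      by (rule measurable_cong[THEN iffD1, rotated]) (simp add: eq)
  next
    show "f \<in> space P \<rightarrow> UNIV \<rightarrow>\<^sub>E space spin_space"
    proof (rule Pi_I, rule PiE_I)
      fix x and j :: "'d site" assume x: "x \<in> space P"
      have "g (Suc (to_nat j)) x \<in> space config_space" using g x by (rule measurable_space)
      then have "g (Suc (to_nat j)) x j \<in> space spin_space" by (simp add: space_config)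
      then show "f x j \<in> space spin_space" using eq[OF x, of j "Suc (to_nat j)"] by simp
    qed simp
  qed
  have sets: "sets \<mu> = sets config_space" using law[of 0] by auto
  show "distr P config_space f = \<mu>"
  proof (rule measure_eqI_PiM_infinite[where I = UNIV and M = "\<lambda>_. spin_space"])
    show "finite_measure (distr P config_space f)"
      using prob_space_distr[OF f] by (simp add: prob_space_def)
    fix A and K :: "'d site set"
    assume K: "finite K" and A: "\<And>i. i \<in> K \<Longrightarrow> A i \<in> sets spin_space"
    let ?C = "prod_emb UNIV (\<lambda>_. spin_space) K (Pi\<^sub>E K A)"
    have C: "?C \<in> sets config_space"
      unfolding config_space_def using K A by (intro sets_PiM_I) auto
    obtain n where n: "\<forall>j\<in>K. to_nat j < n"
      using K finite_nat_set_iff_bounded[of "to_nat ` K"] by auto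
    have "f -` ?C \<inter> space P = g n -` ?C \<inter> space P"
    proof -
      have "f x \<in> ?C \<longleftrightarrow> g n x \<in> ?C" if x: "x \<in> space P" for x
      proof -
        have "f x \<in> space config_space" "g n x \<in> space config_space"
          using measurable_space[OF f x] measurable_space[OF g x] by auto
        moreover have "\<forall>j\<in>K. f x j = g n x j" using n eq[OF x] by auto
        ultimately show ?thesis by (auto simp: prod_emb_def space_config PiE_iff)
      qed
      then show ?thesis by auto
    qed
    then show "emeasure (distr P config_space f) ?C = emeasure \<mu> ?C"
      using law[of n] emeasure_distr[OF f C] emeasure_distr[OF g C, of n] by simp
  qed (auto simp: config_space_def sets[unfolded config_space_def])
qed

text \<open>
  The test on \<open>n\<close> skips the numbers that do not encode a site. It makes every site \<open>j\<close> be
  visited exactly once, at time \<open>to_nat j\<close>, whatever \<open>from_nat\<close> does on the other numbers.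
\<close>
definition sweep_step ::
    "('d::finite site \<Rightarrow> 'd config \<Rightarrow> real) \<Rightarrow> ('d site \<Rightarrow> 'd config \<Rightarrow> real) \<Rightarrow>
      nat \<Rightarrow> 'd config \<times> 'd config \<Rightarrow> real \<Rightarrow> 'd config \<times> 'd config" where
  "sweep_step p q n \<omega> u =
     (if to_nat (from_nat n :: 'd site) = n then couple_resample p q (from_nat n) \<omega> u else \<omega>)"

abbreviation sweep where "sweep p q \<equiv> iterate_steps (sweep_step p q)"

lemma sweep_coordinate_settled:
  assumes "to_nat j < n"
  shows "fst (sweep p q n \<omega> u) j = fst (sweep p q (Suc (to_nat j)) \<omega> u) j"
    and "snd (sweep p q n \<omega> u) j = snd (sweep p q (Suc (to_nat j)) \<omega> u) j"
proof -
  have "Suc (to_nat j) \<le> n" using assms by simp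
  then have "fst (sweep p q n \<omega> u) j = fst (sweep p q (Suc (to_nat j)) \<omega> u) j \<and>
     snd (sweep p q n \<omega> u) j = snd (sweep p q (Suc (to_nat j)) \<omega> u) j"
  proof (induction rule: dec_induct)
    case (step n)
    have "j \<noteq> from_nat n \<or> to_nat (from_nat n :: (int, 'a) vec) \<noteq> n" using step.hyps by auto
    then have "fst (sweep p q (Suc n) \<omega> u) j = fst (sweep p q n \<omega> u) j \<and>
        snd (sweep p q (Suc n) \<omega> u) j = snd (sweep p q n \<omega> u) j"
      by (auto simp: sweep_step_def couple_resample_def resample_def)
    with step.IH show ?case by simp
  qed simp
  then show "fst (sweep p q n \<omega> u) j = fst (sweep p q (Suc (to_nat j)) \<omega> u) j"
    and "snd (sweep p q n \<omega> u) j = snd (sweep p q (Suc (to_nat j)) \<omega> u) j" by auto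
qed

lemma measurable_sweep_step:
  assumes "single_site_spec p" "single_site_spec q"
  shows "(\<lambda>(\<omega>, u). sweep_step p q n \<omega> u) \<in>
     (config_space \<Otimes>\<^sub>M config_space) \<Otimes>\<^sub>M unif \<rightarrow>\<^sub>M config_space \<Otimes>\<^sub>M config_space"
proof (cases "to_nat (from_nat n :: 'a site) = n")
  case True
  then show ?thesis
    using measurable_couple_resample[OF assms, of "from_nat n"] by (simp add: sweep_step_def)
next
  case False
  then show ?thesis by (simp add: sweep_step_def)
qed

text \<open>
  Since \<open>e \<le> r\<close>, the bound \<open>r\<close> on all disagreement probabilities survives each update, so the
  hypothesis on the conditional probabilities stays applicable and pushes each site to \<open>e\<close> when it is
  visited. From then on the site is left alone, so the limiting coupling inherits the bound \<open>e\<close>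
  everywhere.
\<close>
lemma sweep_coupling:
  fixes p q :: "'d::finite site \<Rightarrow> 'd config \<Rightarrow> real"
  assumes p: "single_site_spec p" "single_site_cond_probs p \<mu>"
    and q: "single_site_spec q" "single_site_cond_probs q \<nu>"
    and influence: "\<And>Q i. Q \<in> couplings \<mu> \<nu> \<Longrightarrow> (\<forall>j. disagreement Q j \<le> r) \<Longrightarrow>
        (\<integral>\<^sup>+\<omega>. ennreal \<bar>p i ((fst \<omega>)(i := 1)) - q i ((snd \<omega>)(i := 1))\<bar> \<partial>Q) \<le> ennreal e"
    and e: "0 \<le> e" "e \<le> r"
    and Q: "Q \<in> couplings \<mu> \<nu>" "\<forall>j. disagreement Q j \<le> r"
  shows "\<exists>Q'\<in>couplings \<mu> \<nu>. \<forall>j. disagreement Q' j \<le> e"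
proof -
  let ?E = "config_space \<Otimes>\<^sub>M config_space :: ('d config \<times> 'd config) measure"
  note Q' = couplingsD[OF Q(1)]
  interpret Q: prob_space Q by (rule Q'(1))
  interpret P: pair_prob_space Q unif_seq ..
  note [measurable_cong] = Q'(2)
  let ?P = "Q \<Otimes>\<^sub>M unif_seq"
  define X where "X n = (\<lambda>(\<omega>, u). sweep p q n \<omega> u)" for n
  have step: "(\<lambda>(\<omega>, u). sweep_step p q n \<omega> u) \<in> ?E \<Otimes>\<^sub>M unif \<rightarrow>\<^sub>M ?E" for n
    by (rule measurable_sweep_step[OF p(1) q(1)])
  have X: "X n \<in> ?P \<rightarrow>\<^sub>M ?E" for n
    using measurable_iterate_steps[where step = "sweep_step p q" and n = n, OF step] unfolding X_def
    by (simp add: measurable_cong_sets[OF sets_pair_measure_cong[OF Q'(2) refl] refl])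
  define law where "law n = distr ?P ?E (X n)" for n
  have law_Suc: "law (Suc n) = distr (law n \<Otimes>\<^sub>M unif) ?E (\<lambda>(\<omega>, u). sweep_step p q n \<omega> u)" for n
    unfolding law_def X_def by (rule distr_iterate_steps_Suc[OF step Q'(1,2)])
  have law_0: "law 0 = Q"
  proof -
    have "law 0 = distr ?P Q fst"
      unfolding law_def X_def using Q'(2) by (intro distr_cong) auto
    then show ?thesis by (simp add: unif_seq.distr_pair_fst)
  qed
  have law_updated: "law (Suc n) = distr (law n \<Otimes>\<^sub>M unif) ?E (\<lambda>(\<omega>, u). couple_resample p q (from_nat n) \<omega> u)"
    if "to_nat (from_nat n :: 'd site) = n" for n
    using that by (simp add: law_Suc sweep_step_def)
  have law_same: "law (Suc n) = law n" if "to_nat (from_nat n :: 'd site) \<noteq> n" for n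
  proof -
    have "law (Suc n) = distr (law n \<Otimes>\<^sub>M unif) (law n) fst"
      using that unfolding law_Suc by (intro distr_cong) (auto simp: sweep_step_def law_def)
    then show ?thesis by (simp add: unif.distr_pair_fst)
  qed
  have law: "law n \<in> couplings \<mu> \<nu> \<and> (\<forall>j. disagreement (law n) j \<le> r)" for n
  proof (induction n)
    case 0
    then show ?case using Q by (simp add: law_0)
  next
    case (Suc n)
    show ?case
    proof (cases "to_nat (from_nat n :: 'd site) = n")
      case True
      have c: "law n \<in> couplings \<mu> \<nu>" using Suc by simp
      have "disagreement (law (Suc n)) j \<le> r" for j
      proof (cases "j = from_nat n")
        case True
        then show ?thesis
          using disagreement_couple_resample_same[OF p(1) q(1) c influence[OF c] e(1), of "from_nat n"]
            law_updated[OF \<open>to_nat (from_nat n) = n\<close>] Suc e(2) by simp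
      next
        case False
        then show ?thesis
          using disagreement_couple_resample_other[OF p(1) q(1) c False] Suc
            law_updated[OF \<open>to_nat (from_nat n) = n\<close>] by simp
      qed
      moreover have "law (Suc n) \<in> couplings \<mu> \<nu>"
        unfolding law_updated[OF True] by (rule coupling_couple_resample[OF p q c])
      ultimately show ?thesis by simp
    next
      case False
      then show ?thesis using law_same Suc by simp
    qed
  qed
  have updated: "disagreement (law (Suc (to_nat j))) j \<le> e" for j
  proof -
    have c: "law (to_nat j) \<in> couplings \<mu> \<nu>" and l: "\<forall>i. disagreement (law (to_nat j)) i \<le> r"
      using law by auto
    show ?thesis
      using disagreement_couple_resample_same[OF p(1) q(1) c influence[OF c l] e(1)]
        law_updated[of "to_nat j"] by simp
  qed
  \<comment> \<open>The limit of the sweep: each coordinate is read off right after its only update.\<close>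
  define Z where "Z x = (\<lambda>j. fst (X (Suc (to_nat j)) x) j, \<lambda>j. snd (X (Suc (to_nat j)) x) j)" for x
  have settled: "fst (X n x) j = fst (Z x) j" "snd (X n x) j = snd (Z x) j" if "to_nat j < n" for n j x
    using sweep_coordinate_settled[OF that, of p q "fst x" "snd x"]
    unfolding X_def Z_def case_prod_beta fst_conv snd_conv by (simp_all only:)
  have marg1: "distr ?P config_space (\<lambda>x. fst (X n x)) = \<mu>" for n
  proof -
    have "distr ?P config_space (\<lambda>x. fst (X n x)) = distr (law n) config_space fst"
      unfolding law_def by (simp add: distr_distr[OF measurable_fst X] comp_def)
    then show ?thesis using couplingsD(4)[OF conjunct1[OF law[of n]]] by simp
  qed
  have marg2: "distr ?P config_space (\<lambda>x. snd (X n x)) = \<nu>" for n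
  proof -
    have "distr ?P config_space (\<lambda>x. snd (X n x)) = distr (law n) config_space snd"
      unfolding law_def by (simp add: distr_distr[OF measurable_snd X] comp_def)
    then show ?thesis using couplingsD(5)[OF conjunct1[OF law[of n]]] by simp
  qed
  have Xm: "(\<lambda>x. fst (X n x)) \<in> ?P \<rightarrow>\<^sub>M config_space" "(\<lambda>x. snd (X n x)) \<in> ?P \<rightarrow>\<^sub>M config_space" for n
    by (auto intro: measurable_compose[OF X])
  note Z1 = distr_eventually_constant_coordinates[where f = "\<lambda>x. fst (Z x)",
      OF Xm(1) marg1 P.prob_space_axioms settled(1)]
  note Z2 = distr_eventually_constant_coordinates[where f = "\<lambda>x. snd (Z x)",
      OF Xm(2) marg2 P.prob_space_axioms settled(2)]
  have Z: "Z \<in> ?P \<rightarrow>\<^sub>M ?E"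
    using measurable_Pair[OF Z1(1) Z2(1)] by simp
  show ?thesis
  proof (intro bexI allI)
    show "distr ?P ?E Z \<in> couplings \<mu> \<nu>"
    proof -
      have "distr (distr ?P ?E Z) config_space fst = \<mu>" "distr (distr ?P ?E Z) config_space snd = \<nu>"
        by (simp_all only: distr_distr[OF measurable_fst Z] distr_distr[OF measurable_snd Z] comp_def
              Z1(2) Z2(2))
      then show ?thesis
        using P.prob_space_distr[OF Z] by (simp add: couplings_def)
    qed
    fix j
    have A: "{\<omega> \<in> space ?E. fst \<omega> j \<noteq> snd \<omega> j} \<in> sets ?E" by measurable
    have "disagreement (distr ?P ?E Z) j = disagreement (law (Suc (to_nat j))) j"
    proof -
      have "Z -` {\<omega> \<in> space ?E. fst \<omega> j \<noteq> snd \<omega> j} \<inter> space ?P =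
          X (Suc (to_nat j)) -` {\<omega> \<in> space ?E. fst \<omega> j \<noteq> snd \<omega> j} \<inter> space ?P"
      proof -
        have "Z x \<in> {\<omega> \<in> space ?E. fst \<omega> j \<noteq> snd \<omega> j} \<longleftrightarrow>
            X (Suc (to_nat j)) x \<in> {\<omega> \<in> space ?E. fst \<omega> j \<noteq> snd \<omega> j}" if x: "x \<in> space ?P" for x
          using measurable_space[OF Z x] measurable_space[OF X x] settled[of j "Suc (to_nat j)" x]
          by simp
        then show ?thesis by blast
      qed
      then show ?thesis
        unfolding disagreement_def law_def by (simp add: measure_distr[OF Z A] measure_distr[OF X A])
    qed
    then show "disagreement (distr ?P ?E Z) j \<le> e" using updated by simp
  qed
qed

section \<open>The contraction bound for the distance\<close>
text \<open>
  Without a coupling the infimum defining the distance would be an unspecified value.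
\<close>
lemma product_coupling:
  fixes \<mu> \<nu> :: "'d::finite config measure"
  assumes "prob_space \<mu>" "prob_space \<nu>" "sets \<mu> = sets config_space" "sets \<nu> = sets config_space"
  shows "\<mu> \<Otimes>\<^sub>M \<nu> \<in> couplings \<mu> \<nu>"
proof -
  interpret \<mu>: prob_space \<mu> by fact
  interpret \<nu>: prob_space \<nu> by fact
  interpret P: pair_prob_space \<mu> \<nu> ..
  have "distr (\<mu> \<Otimes>\<^sub>M \<nu>) config_space fst = distr (\<mu> \<Otimes>\<^sub>M \<nu>) \<mu> fst"
    "distr (\<mu> \<Otimes>\<^sub>M \<nu>) config_space snd = distr (\<mu> \<Otimes>\<^sub>M \<nu>) \<nu> snd"
    using assms by (auto intro: distr_cong)
  moreover have "distr (\<mu> \<Otimes>\<^sub>M \<nu>) \<nu> snd = \<nu>"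
  proof (rule measure_eqI)
    fix A assume "A \<in> sets (distr (\<mu> \<Otimes>\<^sub>M \<nu>) \<nu> snd)"
    then have A: "A \<in> sets \<nu>" by simp
    then have "snd -` A \<inter> space (\<mu> \<Otimes>\<^sub>M \<nu>) = space \<mu> \<times> A"
      using sets.sets_into_space[OF A] by (auto simp: space_pair_measure)
    then show "emeasure (distr (\<mu> \<Otimes>\<^sub>M \<nu>) \<nu> snd) A = emeasure \<nu> A"
      using A by (simp add: emeasure_distr \<nu>.emeasure_pair_measure_Times \<mu>.emeasure_space_1)
  qed simp
  ultimately show ?thesis
    using assms P.prob_space_axioms by (auto simp: couplings_def \<nu>.distr_pair_fst intro: sets_pair_measure_cong)
qed

text \<open>
  If the distance \<open>d\<close> exceeded \<open>b / (1 - c)\<close>, then \<open>c d + b < d\<close>, and a sweep applied to a coupling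
  with disagreements below some \<open>r > d\<close> close enough to \<open>d\<close> would produce a coupling with
  disagreements at most \<open>c r + b < d\<close>. Arguing with the infimum in this way makes a single sweep
  enough.
\<close>
lemma dbar_le_of_contraction:
  fixes p q :: "'d::finite site \<Rightarrow> 'd config \<Rightarrow> real"
  assumes p: "single_site_spec p" "single_site_cond_probs p \<mu>"
    and q: "single_site_spec q" "single_site_cond_probs q \<nu>"
    and influence: "\<And>Q i r. Q \<in> couplings \<mu> \<nu> \<Longrightarrow> (\<forall>j. disagreement Q j \<le> r) \<Longrightarrow>
        (\<integral>\<^sup>+\<omega>. ennreal \<bar>p i ((fst \<omega>)(i := 1)) - q i ((snd \<omega>)(i := 1))\<bar> \<partial>Q) \<le> ennreal (c * r + b)"
    and c: "0 \<le> c" "c < 1" and b: "0 \<le> b"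
  shows "dbar \<mu> \<nu> \<le> b / (1 - c)"
proof (rule ccontr)
  assume neg: "\<not> dbar \<mu> \<nu> \<le> b / (1 - c)"
  let ?D = "\<lambda>Q. SUP j. disagreement Q j"
  have dbar: "dbar \<mu> \<nu> = (INF Q\<in>couplings \<mu> \<nu>. ?D Q)"
    by (simp add: dbar_def disagreement_def)
  have bdd: "bdd_above (range (disagreement Q))" if "Q \<in> couplings \<mu> \<nu>" for Q
    using prob_space.prob_le_1[OF couplingsD(1)[OF that]]
    by (auto simp: disagreement_def intro!: bdd_aboveI[where M = 1])
  have nonneg: "0 \<le> ?D Q" if "Q \<in> couplings \<mu> \<nu>" for Q
    by (rule cSUP_upper2[OF bdd[OF that] UNIV_I]) (simp add: disagreement_def)
  have below: "bdd_below (?D ` couplings \<mu> \<nu>)"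
    using nonneg by (auto intro!: bdd_belowI[where m = 0])
  have ne: "couplings \<mu> \<nu> \<noteq> {}"
    using product_coupling[of \<mu> \<nu>] p(2) q(2) unfolding single_site_cond_probs_def by auto
  define d where "d = dbar \<mu> \<nu>"
  have cd: "c * d + b < d"
    using neg c by (simp add: d_def field_simps)
  \<comment> \<open>The excess of \<open>r\<close> over \<open>d\<close> is the gap \<open>d - (c d + b)\<close>, which a factor \<open>c < 1\<close> cannot close.\<close>
  define r where "r = d + (d - (c * d + b))"
  have "d < r" using cd by (simp add: r_def)
  then obtain Q where Q: "Q \<in> couplings \<mu> \<nu>" "?D Q < r"
    unfolding d_def dbar using cInf_lessD[of "?D ` couplings \<mu> \<nu>"] ne by auto
  have le_r: "\<forall>j. disagreement Q j \<le> r"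
  proof
    fix j
    have "disagreement Q j \<le> ?D Q" by (rule cSUP_upper[OF UNIV_I bdd[OF Q(1)]])
    then show "disagreement Q j \<le> r" using Q(2) by simp
  qed
  have r0: "0 \<le> r" using nonneg[OF Q(1)] Q(2) by simp
  have lt: "c * r + b < d"
  proof -
    have "c * (r - d) < 1 * (r - d) \<or> False"
      using c \<open>d < r\<close> by (simp add: mult_strict_right_mono)
    then show ?thesis by (simp add: r_def algebra_simps)
  qed
  have e: "0 \<le> c * r + b" "c * r + b \<le> r" using r0 c b lt \<open>d < r\<close> by auto
  have "\<exists>Q'\<in>couplings \<mu> \<nu>. \<forall>j. disagreement Q' j \<le> c * r + b"
    by (rule sweep_coupling[OF p q influence e Q(1) le_r])
  then obtain Q' where Q': "Q' \<in> couplings \<mu> \<nu>" "\<forall>j. disagreement Q' j \<le> c * r + b"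
    by blast
  have "d \<le> ?D Q'" unfolding d_def dbar by (rule cINF_lower[OF below Q'(1)])
  also have "\<dots> \<le> c * r + b" using Q'(2) by (intro cSUP_least) auto
  finally show False using lt by simp
qed

section \<open>Balls, bonds and shells\<close>
definition shell :: "'d::finite site \<Rightarrow> nat \<Rightarrow> 'd site set set" where
  "shell i k = bonds_inside i k \<inter> bonds_outside i (k - 1)"

text \<open>
  The index of the shell around \<open>i\<close> to which the bond \<open>B\<close> belongs.
\<close>
definition radius :: "'d::finite site \<Rightarrow> 'd site set \<Rightarrow> nat" where
  "radius i B = (LEAST k. B \<subseteq> site_ball i k)"

lemma finite_site_ball: "finite (site_ball i k)"
proof (rule inj_on_finite)
  show "inj_on vec_nth (site_ball i k)" by (simp add: inj_on_def vec_nth_inject)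
  show "vec_nth ` site_ball i k \<subseteq> (\<Pi>\<^sub>E l\<in>UNIV. {i $ l - int k..i $ l + int k})"
  proof (rule image_subsetI, rule PiE_I)
    fix j l assume "j \<in> site_ball i k"
    then have "\<bar>(j - i) $ l\<bar> \<le> int k"
      using member_le_sum[of l UNIV "\<lambda>l. \<bar>(j - i) $ l\<bar>"]
      by (simp add: site_ball_def site_norm_def)
    then show "j $ l \<in> {i $ l - int k..i $ l + int k}" by (auto simp: abs_le_iff)
  qed simp
qed (auto intro!: finite_PiE)

lemma card_site_ball_translate:
  fixes i :: "'d::finite site"
  shows "card (site_ball i k) = card (site_ball (0 :: 'd site) k)"
proof -
  have "bij_betw ((+) i) (site_ball 0 k) (site_ball i k)"
    by (rule bij_betw_byWitness[where f' = "\<lambda>j. j - i"]) (auto simp: site_ball_def)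
  then show ?thesis using bij_betw_same_card by metis
qed

lemma site_ball_mono: "k \<le> l \<Longrightarrow> site_ball i k \<subseteq> site_ball i l"
  by (auto simp: site_ball_def)

lemma site_ball_0: "site_ball i 0 = {i}"
proof -
  have "j = i" if "site_norm (j - i) \<le> 0" for j :: "'a site"
  proof -
    have "(\<Sum>k\<in>UNIV. \<bar>(j - i) $ k\<bar>) = 0"
      using that by (intro antisym) (auto simp: site_norm_def intro: sum_nonneg)
    then have "\<forall>k. (j - i) $ k = 0" by (simp add: sum_nonneg_eq_0_iff)
    then show ?thesis by (simp add: vec_eq_iff)
  qed
  then show ?thesis by (auto simp: site_ball_def site_norm_def)
qed

text \<open>
  A ball of radius \<open>0\<close> is a single site, whereas bonds have at least two.
\<close>
lemma bonds_outside_0: "bonds_outside i 0 = bonds i"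
proof -
  have "\<not> B \<subseteq> {i}" if "B \<in> bonds i" for B
    using that card_mono[of "{i}" B] by (auto simp: bonds_def)
  then show ?thesis by (auto simp: bonds_outside_def site_ball_0)
qed

lemma shell_subset: "shell i k \<subseteq> bonds i"
  and bonds_outside_subset: "bonds_outside i k \<subseteq> bonds i"
  and bonds_inside_subset: "bonds_inside i k \<subseteq> bonds i"
  by (auto simp: shell_def bonds_inside_def bonds_outside_def)

lemma bonds_outside_pred:
  assumes "1 \<le> k"
  shows "bonds_outside i (k - 1) = bonds_outside i k \<union> shell i k" "bonds_outside i k \<inter> shell i k = {}"
  using site_ball_mono[of "k - 1" k i]
  by (auto simp: shell_def bonds_outside_def bonds_inside_def)

lemma countable_bonds: "countable (bonds i)"
proof (rule countable_subset)
  show "bonds i \<subseteq> {B. finite B}" by (auto simp: bonds_def)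
qed (rule countable_Collect_finite)

lemma bond_in_shell:
  assumes B: "B \<in> bonds i"
  shows "1 \<le> radius i B" "B \<in> shell i (radius i B)"
proof -
  have fin: "finite B" using B by (simp add: bonds_def)
  have "\<exists>k. B \<subseteq> site_ball i k"
  proof
    have "site_norm (j - i) \<ge> 0" for j by (simp add: site_norm_def sum_nonneg)
    moreover have "site_norm (j - i) \<le> Max ((\<lambda>j. site_norm (j - i)) ` B)" if "j \<in> B" for j
      using that fin by (intro Max_ge) auto
    ultimately show "B \<subseteq> site_ball i (nat (Max ((\<lambda>j. site_norm (j - i)) ` B)))"
      unfolding site_ball_def by (smt (verit) int_nat_eq mem_Collect_eq subsetI)
  qed
  then have inside: "B \<subseteq> site_ball i (radius i B)"
    unfolding radius_def by (rule LeastI_ex)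
  have "B \<in> bonds_outside i 0" using B by (simp add: bonds_outside_0)
  then have not0: "\<not> B \<subseteq> site_ball i 0" unfolding bonds_outside_def by blast
  have "radius i B \<noteq> 0"
  proof
    assume "radius i B = 0"
    then show False using inside not0 by (simp only:)
  qed
  then show "1 \<le> radius i B" by simp
  then have "\<not> B \<subseteq> site_ball i (radius i B - 1)"
    unfolding radius_def by (intro not_less_Least) simp
  then show "B \<in> shell i (radius i B)"
    using inside B by (simp add: shell_def bonds_inside_def bonds_outside_def)
qed

section \<open>Heat bath probabilities\<close>
lemma abs_chi:
  assumes "\<sigma> \<in> space config_space" shows "\<bar>chi B \<sigma>\<bar> = 1"
proof -
  have "\<bar>\<sigma> i\<bar> = 1" for i using spin_cases[OF assms, of i] by auto
  then show ?thesis by (simp add: chi_def abs_prod)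
qed

text \<open>
  As each bond at \<open>i\<close> contains \<open>i\<close> exactly once, reversing the spin at \<open>i\<close> reverses the local
  field, so the two conditional probabilities add up to one.
\<close>
lemma chi_flip:
  assumes "B \<in> bonds i" shows "chi B (\<sigma>(i := -1)) = - chi B (\<sigma>(i := 1))"
proof -
  have B: "finite B" "i \<in> B" using assms by (auto simp: bonds_def)
  have "(\<Prod>j\<in>B - {i}. (\<sigma>(i := -1)) j) = (\<Prod>j\<in>B - {i}. (\<sigma>(i := 1)) j)"
    by (intro prod.cong) auto
  then show ?thesis
    unfolding chi_def by (simp add: prod.remove[OF B])
qed

lemma chi_diff:
  assumes "finite B" "\<sigma> \<in> space config_space" "\<tau> \<in> space config_space"
  shows "\<bar>chi B \<sigma> - chi B \<tau>\<bar> \<le> 2 * real (card {j \<in> B. \<sigma> j \<noteq> \<tau> j})"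
proof (cases "{j \<in> B. \<sigma> j \<noteq> \<tau> j} = {}")
  case True
  then have "chi B \<sigma> = chi B \<tau>" unfolding chi_def by (intro prod.cong) auto
  then show ?thesis by simp
next
  case False
  then have "1 \<le> card {j \<in> B. \<sigma> j \<noteq> \<tau> j}"
    using assms(1) by (simp add: Suc_le_eq card_gt_0_iff)
  moreover have "\<bar>chi B \<sigma> - chi B \<tau>\<bar> \<le> 2"
    using abs_chi[OF assms(2), of B] abs_chi[OF assms(3), of B] by linarith
  ultimately show ?thesis by (smt (verit) of_nat_1 of_nat_mono)
qed

lemma measurable_chi [measurable]: "chi B \<in> borel_measurable config_space"
  unfolding chi_def by measurable

definition logistic :: "real \<Rightarrow> real" where
  "logistic x = inverse (1 + exp (- x))"

lemma logistic_range: "0 \<le> logistic x"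
  by (simp add: logistic_def add_nonneg_nonneg)

lemma logistic_minus: "logistic x + logistic (- x) = 1"
proof -
  have "1 + exp x \<noteq> 0" "1 + exp (-x) \<noteq> 0" by (smt (verit) exp_gt_zero)+
  then show ?thesis by (simp add: logistic_def divide_simps exp_minus) (simp add: algebra_simps)
qed

text \<open>
  The derivative \<open>y / (1 + y)^2\<close> with \<open>y = exp (- x)\<close> is at most \<open>1/4\<close> because \<open>(1 - y)^2 \<ge> 0\<close>. A
  constant \<open>a\<close> makes the truncation error \<open>2 a \<beta> t\<close>, so only \<open>a < 1/2\<close> keeps it a definite
  factor below \<open>1 - exp (- \<beta> t)\<close> for small \<open>\<beta>\<close>.
\<close>
lemma logistic_lipschitz: "\<bar>logistic x - logistic y\<bar> \<le> \<bar>x - y\<bar> / 4"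
proof -
  have *: "0 \<le> logistic v - logistic u \<and> logistic v - logistic u \<le> (v - u) / 4" if "u \<le> v" for u v
  proof
    have pos: "0 < 1 + exp (- z)" for z :: real by (simp add: add_pos_pos)
    show "0 \<le> logistic v - logistic u"
      using that pos by (auto simp: logistic_def intro!: le_imp_inverse_le)
    have "v / 4 - logistic v \<ge> u / 4 - logistic u"
    proof (rule DERIV_nonneg_imp_nondecreasing[OF that])
      fix z :: real
      have "(logistic has_real_derivative exp (-z) / (1 + exp (-z))^2) (at z)"
        unfolding logistic_def[abs_def] using pos[of z]
        by (auto intro!: derivative_eq_intros simp: power2_eq_square field_simps)
      from DERIV_diff[OF DERIV_cdivide[OF DERIV_ident, of 4] this]
      have "((\<lambda>z. z / 4 - logistic z) has_real_derivative 1/4 - exp (-z) / (1 + exp (-z))^2) (at z)"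
        by simp
      moreover have "1/4 - exp (-z) / (1 + exp (-z))^2 \<ge> 0"
      proof -
        have "4 * exp (-z) \<le> (1 + exp (-z))^2"
          using zero_le_power2[of "1 - exp (-z)"] by (simp add: power2_eq_square algebra_simps)
        then show ?thesis using pos[of z] by (simp add: field_simps)
      qed
      ultimately show "\<exists>y. ((\<lambda>z. z / 4 - logistic z) has_real_derivative y) (at z) \<and> 0 \<le> y" by blast
    qed
    then show "logistic v - logistic u \<le> (v - u) / 4" by (simp add: field_simps)
  qed
  show ?thesis
  proof (cases "x \<le> y")
    case True
    then show ?thesis using *[of x y] by simp
  next
    case False
    then show ?thesis using *[of y x] by simp
  qed
qed

lemma exp_diff_le:
  assumes "0 \<le> x" "x \<le> y" shows "exp (- x) - exp (- y) \<le> y - (x::real)"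
proof -
  have "exp (- x) - exp (- y) = exp (- x) * (1 - exp (x - y))"
    by (simp add: algebra_simps flip: exp_add)
  also have "\<dots> \<le> 1 * (1 - exp (x - y))"
    using assms by (intro mult_right_mono) auto
  also have "\<dots> \<le> y - x" unfolding mult_1 using exp_ge_add_one_self[of "x - y"] by linarith
  finally show ?thesis .
qed

text \<open>
  From \<open>exp (- x) \<le> 1 / (1 + x)\<close> and \<open>x \<le> 1/3\<close> one gets \<open>exp (- x) \<le> 1 - 3 x / 4\<close>.
\<close>
lemma half_le_two_thirds_exp:
  assumes "0 \<le> x" "x \<le> (1/3::real)" shows "x / 2 \<le> 2/3 * (1 - exp (- x))"
proof -
  have "exp (- x) \<le> 1 / (1 + x)"
    using exp_ge_add_one_self[of x] assms by (simp add: exp_minus field_simps)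
  also have "\<dots> \<le> 1 - 3/4 * x"
  proof -
    have "3 * x * x \<le> 1 * x" using assms by (intro mult_right_mono) auto
    then show ?thesis using assms by (simp add: field_simps)
  qed
  finally show ?thesis by simp
qed

definition field_from :: "('d::finite site set \<Rightarrow> real) \<Rightarrow> 'd site set set \<Rightarrow> 'd config \<Rightarrow> real" where
  "field_from J A \<sigma> = (\<Sum>\<^sub>\<infinity>B\<in>A. J B * chi B \<sigma>)"

text \<open>
  The set \<open>A i\<close> of bonds acting on \<open>i\<close> covers the full and the truncated interaction at once.
\<close>
definition heat_bath ::
    "real \<Rightarrow> ('d::finite site set \<Rightarrow> real) \<Rightarrow> ('d site \<Rightarrow> 'd site set set) \<Rightarrow> 'd site \<Rightarrow> 'd config \<Rightarrow> real" where
  "heat_bath \<beta> J A i \<sigma> = logistic (2 * \<beta> * field_from J (A i) \<sigma>)"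

lemma gibbs_measure_heat_bath:
  "gibbs_measure \<beta> J = single_site_cond_probs (heat_bath \<beta> J bonds)"
  "truncated_gibbs_measure \<beta> J L = single_site_cond_probs (heat_bath \<beta> J (\<lambda>i. bonds_inside i L))"
  by (simp_all add: gibbs_measure_def truncated_gibbs_measure_def heat_bath_def[abs_def] logistic_def
      field_from_def)

lemma summable_chi:
  assumes "(\<lambda>B. \<bar>J B\<bar>) summable_on A" "\<sigma> \<in> space config_space"
  shows "(\<lambda>B. norm (J B * chi B \<sigma>)) summable_on A"
  using assms by (simp add: abs_mult abs_chi)

text \<open>
  On configurations the sum converges absolutely, so it is an integral with respect to the counting
  measure on the countable set \<open>A\<close>, and integrals depend measurably on parameters.
\<close>
lemma measurable_field_from:
  assumes J: "(\<lambda>B. \<bar>J B\<bar>) summable_on A" and A: "countable A"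
  shows "field_from J A \<in> borel_measurable config_space"
proof -
  interpret sigma_finite_measure "count_space A"
    by (rule sigma_finite_measure_count_space_countable) fact
  have "(\<lambda>x. J (snd x) * chi (snd x) (fst x)) \<in> borel_measurable (config_space \<Otimes>\<^sub>M count_space A)"
    by (rule measurable_compose_countable'[where g = snd and I = A]) (use A in measurable)
  then have m: "(\<lambda>\<sigma>. \<integral>B. J B * chi B \<sigma> \<partial>count_space A) \<in> borel_measurable config_space"
    by (intro borel_measurable_lebesgue_integral) (simp add: case_prod_beta')
  have "field_from J A \<sigma> = (\<integral>B. J B * chi B \<sigma> \<partial>count_space A)" if "\<sigma> \<in> space config_space" for \<sigma>
    using infsetsum_infsum[OF abs_summable_equivalent[THEN iffD1, OF summable_chi[OF J that]]]
    by (simp add: field_from_def infsetsum_def)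
  then show ?thesis using m by (rule measurable_cong[THEN iffD2])
qed

lemma single_site_spec_heat_bath:
  assumes J: "\<And>i. (\<lambda>B. \<bar>J B\<bar>) summable_on bonds i" and A: "\<And>i. A i \<subseteq> bonds i"
  shows "single_site_spec (heat_bath \<beta> J A)"
proof
  fix i \<sigma>
  show "heat_bath \<beta> J A i \<in> borel_measurable config_space"
  proof -
    have "(\<lambda>B. \<bar>J B\<bar>) summable_on A i" using J A by (rule summable_on_subset_banach)
    moreover have "countable (A i)" using A countable_bonds by (rule countable_subset)
    ultimately have [measurable]: "field_from J (A i) \<in> borel_measurable config_space"
      by (rule measurable_field_from)
    show ?thesis unfolding heat_bath_def[abs_def] logistic_def by measurable
  qed
  show "0 \<le> heat_bath \<beta> J A i \<sigma>" by (simp add: heat_bath_def logistic_range)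
  have "field_from J (A i) (\<sigma>(i := -1)) = - field_from J (A i) (\<sigma>(i := 1))"
  proof -
    have "field_from J (A i) (\<sigma>(i := -1)) = (\<Sum>\<^sub>\<infinity>B\<in>A i. - (J B * chi B (\<sigma>(i := 1))))"
      unfolding field_from_def
    proof (rule infsum_cong)
      fix B assume "B \<in> A i"
      then have "B \<in> bonds i" using A by auto
      then show "J B * chi B (\<sigma>(i := -1)) = - (J B * chi B (\<sigma>(i := 1)))" by (simp add: chi_flip)
    qed
    then show ?thesis by (simp add: field_from_def infsum_uminus)
  qed
  then show "heat_bath \<beta> J A i (\<sigma>(i := 1)) + heat_bath \<beta> J A i (\<sigma>(i := -1)) = 1"
    using logistic_minus by (simp add: heat_bath_def)
qed

section \<open>Sums of nonnegative terms\<close>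
lemma nonneg_infsum_le:
  fixes f :: "'a \<Rightarrow> real"
  assumes "\<And>x. x \<in> A \<Longrightarrow> 0 \<le> f x" and "\<And>F. finite F \<Longrightarrow> F \<subseteq> A \<Longrightarrow> sum f F \<le> c"
  shows "f summable_on A" "infsum f A \<le> c"
proof -
  show "f summable_on A"
    using assms by (intro nonneg_bdd_above_summable_on bdd_aboveI[where M = c]) auto
  then show "infsum f A \<le> c" using assms(2) by (rule infsum_le_finite_sums)
qed

lemma sum_le_ennreal_infsum:
  fixes f :: "'a \<Rightarrow> ennreal"
  assumes "finite F" "F \<subseteq> A" shows "sum f F \<le> infsum f A"
  using assms by (subst nonneg_infsum_complete) (auto intro: SUP_upper)

lemma ennreal_infsum_le_infsum:
  fixes f :: "'a \<Rightarrow> real"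
  assumes "f summable_on A" "\<And>x. x \<in> A \<Longrightarrow> 0 \<le> f x"
  shows "ennreal (infsum f A) \<le> (\<Sum>\<^sub>\<infinity>x\<in>A. ennreal (f x))"
proof -
  have "ennreal (sum f F) \<le> (\<Sum>\<^sub>\<infinity>x\<in>A. ennreal (f x))" if F: "finite F" "F \<subseteq> A" for F
  proof -
    have "ennreal (sum f F) = (\<Sum>x\<in>F. ennreal (f x))"
      using F assms(2) by (intro sum_ennreal[symmetric]) auto
    then show ?thesis using sum_le_ennreal_infsum[OF F] by simp
  qed
  then have "(SUP F\<in>{F. finite F \<and> F \<subseteq> A}. ennreal (sum f F)) \<le> (\<Sum>\<^sub>\<infinity>x\<in>A. ennreal (f x))"
    by (intro SUP_least) auto
  then show ?thesis
    using infsum_nonneg_is_SUPREMUM_ennreal[OF assms] by (simp only:)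
qed

lemma nn_integral_count_space_infsum:
  fixes f :: "'a \<Rightarrow> real"
  assumes f: "f summable_on A" "\<And>x. x \<in> A \<Longrightarrow> 0 \<le> f x"
  shows "(\<integral>\<^sup>+x. ennreal (f x) \<partial>count_space A) = ennreal (infsum f A)"
proof -
  have "(\<lambda>x. norm (f x)) summable_on A"
    using f(1) by (rule summable_on_cong[THEN iffD1, rotated]) (simp add: f(2))
  note abs = abs_summable_equivalent[THEN iffD1, OF this]
  show ?thesis
    using nn_integral_conv_infsetsum[OF abs f(2)] infsetsum_infsum[OF abs] by simp
qed

section \<open>Estimates for decaying interactions\<close>
text \<open>
  The two hypotheses of the theorem as bounds on finite sums of real numbers, which is the form
  in which all later estimates use them.
\<close>
locale decaying_interaction =
  fixes J :: "'d::finite site set \<Rightarrow> real" and S C :: real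
  assumes sum_le: "\<And>i F. finite F \<Longrightarrow> F \<subseteq> bonds i \<Longrightarrow> (\<Sum>B\<in>F. \<bar>J B\<bar>) \<le> S"
    and shells_le: "\<And>i K. finite K \<Longrightarrow> K \<subseteq> {1..} \<Longrightarrow>
           (\<Sum>k\<in>K. real (card (site_ball i k)) * (\<Sum>\<^sub>\<infinity>B\<in>shell i k. \<bar>J B\<bar>)) \<le> C"

lemma ennreal_SUP_less_topE:
  fixes f :: "'a \<Rightarrow> ennreal"
  assumes "(SUP i. f i) < \<infinity>"
  obtains c where "\<And>i. f i \<le> ennreal c" "0 \<le> c"
proof
  fix i
  have "f i \<le> (SUP i. f i)" by (rule SUP_upper) simp
  then show "f i \<le> ennreal (enn2real (SUP i. f i))" using assms by simp
qed simp

lemma ennreal_leD: "ennreal x \<le> ennreal c \<Longrightarrow> 0 \<le> c \<Longrightarrow> x \<le> c"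
  by (simp add: ennreal_le_iff)

lemma decaying_interactionI:
  fixes J :: "'d::finite site set \<Rightarrow> real"
  assumes "interaction J" "fast_decay J"
  obtains S C where "decaying_interaction J S C"
proof -
  obtain S where S: "\<And>i. (\<Sum>\<^sub>\<infinity>B\<in>bonds i. ennreal \<bar>J B\<bar>) \<le> ennreal S" "0 \<le> S"
    using assms(1) unfolding interaction_def by (rule ennreal_SUP_less_topE) auto
  obtain C where C: "\<And>i. (\<Sum>\<^sub>\<infinity>k\<in>{1..}. of_nat (card (site_ball i k)) *
        (\<Sum>\<^sub>\<infinity>B\<in>shell i k. ennreal \<bar>J B\<bar>)) \<le> ennreal C" "0 \<le> C"
    using assms(2) unfolding fast_decay_def shell_def[symmetric] by (rule ennreal_SUP_less_topE) auto
  have sums: "(\<Sum>B\<in>F. \<bar>J B\<bar>) \<le> S" if F: "finite F" "F \<subseteq> bonds i" for F i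
  proof (rule ennreal_leD[OF _ S(2)])
    have "ennreal (\<Sum>B\<in>F. \<bar>J B\<bar>) = (\<Sum>B\<in>F. ennreal \<bar>J B\<bar>)" by simp
    also have "\<dots> \<le> ennreal S" using sum_le_ennreal_infsum[OF F] S(1)[of i] by (rule order_trans)
    finally show "ennreal (\<Sum>B\<in>F. \<bar>J B\<bar>) \<le> ennreal S" .
  qed
  have summable: "(\<lambda>B. \<bar>J B\<bar>) summable_on shell i k" for i k
    using shell_subset[of i k] sums[of _ i] by (intro nonneg_infsum_le(1)[where c = S]) auto
  have "decaying_interaction J S C"
  proof
    fix i and K :: "nat set" assume K: "finite K" "K \<subseteq> {1..}"
    let ?s = "\<lambda>k. \<Sum>\<^sub>\<infinity>B\<in>shell i k. \<bar>J B\<bar>"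
    show "(\<Sum>k\<in>K. real (card (site_ball i k)) * ?s k) \<le> C"
    proof (rule ennreal_leD[OF _ C(2)])
      have "ennreal (\<Sum>k\<in>K. real (card (site_ball i k)) * ?s k) =
          (\<Sum>k\<in>K. of_nat (card (site_ball i k)) * ennreal (?s k))"
        by (subst sum_ennreal[symmetric])
           (auto intro!: sum.cong mult_nonneg_nonneg infsum_nonneg simp: ennreal_mult' ennreal_of_nat_eq_real_of_nat)
      also have "\<dots> \<le> (\<Sum>k\<in>K. of_nat (card (site_ball i k)) * (\<Sum>\<^sub>\<infinity>B\<in>shell i k. ennreal \<bar>J B\<bar>))"
        by (intro sum_mono mult_left_mono ennreal_infsum_le_infsum summable) auto
      also have "\<dots> \<le> ennreal C" using sum_le_ennreal_infsum[OF K] C(1)[of i] by (rule order_trans)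
      finally show "ennreal (\<Sum>k\<in>K. real (card (site_ball i k)) * ?s k) \<le> ennreal C" .
    qed
  qed (rule sums)
  then show thesis by (rule that)
qed

context decaying_interaction
begin

lemma S_nonneg: "0 \<le> S" and C_nonneg: "0 \<le> C"
  using sum_le[of "{}" undefined] shells_le[of "{}" undefined] by simp_all

lemma
  assumes "A \<subseteq> bonds i"
  shows summable: "(\<lambda>B. \<bar>J B\<bar>) summable_on A"
    and infsum_le: "(\<Sum>\<^sub>\<infinity>B\<in>A. \<bar>J B\<bar>) \<le> S"
  by (rule nonneg_infsum_le[where c = S], simp, rule sum_le, assumption, erule order_trans[OF _ assms])+

lemma tail_weight_nonneg: "0 \<le> tail_weight J i k"
  and tail_weight_le: "tail_weight J i k \<le> S"
  unfolding tail_weight_def by (rule infsum_nonneg, simp) (rule infsum_le[OF bonds_outside_subset])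

lemma tail_weight_pred:
  assumes "1 \<le> k"
  shows "tail_weight J i (k - 1) = tail_weight J i k + (\<Sum>\<^sub>\<infinity>B\<in>shell i k. \<bar>J B\<bar>)"
  unfolding tail_weight_def bonds_outside_pred(1)[OF assms]
  by (rule infsum_Un_disjoint[OF summable[OF bonds_outside_subset] summable[OF shell_subset]
        bonds_outside_pred(2)[OF assms]])

text \<open>
  Grouping the bonds by shells, every bond in shell \<open>k\<close> lies in the ball of radius \<open>k\<close>, so its size
  is at most that of the ball.
\<close>
lemma size_weighted_sum_le:
  assumes F: "finite F" "F \<subseteq> bonds i"
  shows "(\<Sum>B\<in>F. \<bar>J B\<bar> * real (card B)) \<le> C"
proof -
  let ?s = "\<lambda>k. \<Sum>\<^sub>\<infinity>B\<in>shell i k. \<bar>J B\<bar>"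
  have "(\<Sum>B\<in>F. \<bar>J B\<bar> * real (card B)) =
      (\<Sum>k\<in>radius i ` F. \<Sum>B\<in>{B \<in> F. radius i B = k}. \<bar>J B\<bar> * real (card B))"
    by (rule sum.image_gen[OF F(1)])
  also have "\<dots> \<le> (\<Sum>k\<in>radius i ` F. real (card (site_ball i k)) * ?s k)"
  proof (rule sum_mono)
    fix k assume "k \<in> radius i ` F"
    let ?F = "{B \<in> F. radius i B = k}"
    have sh: "?F \<subseteq> shell i k" using bond_in_shell(2) F(2) by auto
    then have "card B \<le> card (site_ball i k)" if "B \<in> ?F" for B
      using that finite_site_ball by (intro card_mono) (auto simp: shell_def bonds_inside_def)
    then have "(\<Sum>B\<in>?F. \<bar>J B\<bar> * real (card B)) \<le> (\<Sum>B\<in>?F. \<bar>J B\<bar> * real (card (site_ball i k)))"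
      by (intro sum_mono mult_left_mono) auto
    also have "\<dots> = real (card (site_ball i k)) * (\<Sum>B\<in>?F. \<bar>J B\<bar>)"
      by (simp add: sum_distrib_left mult.commute)
    also have "\<dots> \<le> real (card (site_ball i k)) * ?s k"
      using sh F(1) summable[OF shell_subset]
      by (intro mult_left_mono finite_sum_le_infsum) auto
    finally show "(\<Sum>B\<in>?F. \<bar>J B\<bar> * real (card B)) \<le> real (card (site_ball i k)) * ?s k" .
  qed
  also have "\<dots> \<le> C"
    using F bond_in_shell(1) by (intro shells_le) auto
  finally show ?thesis .
qed

text \<open>
  Passing to a smaller radius adds one shell to the tail weight, and \<open>exp (- x)\<close> has slope at most one
  in absolute value for \<open>x \<ge> 0\<close>. For \<open>k = 1\<close> the second exponent carries twice the total weight,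
  whence the extra \<open>S\<close>.
\<close>
lemma lam_bounds:
  assumes \<beta>: "0 < \<beta>" and k: "1 \<le> k"
  shows "0 \<le> lam \<beta> J i k"
    and "lam \<beta> J i k \<le> \<beta> * ((\<Sum>\<^sub>\<infinity>B\<in>shell i k. \<bar>J B\<bar>) + (if k = 1 then S else 0))"
proof -
  define w where "w = (\<Sum>\<^sub>\<infinity>B\<in>bonds i. \<bar>J B\<bar>)"
  define s where "s = (\<Sum>\<^sub>\<infinity>B\<in>shell i k. \<bar>J B\<bar>)"
  define t where "t = tail_weight J i k"
  have s0: "0 \<le> s" unfolding s_def by (intro infsum_nonneg) auto
  have t0: "0 \<le> t" unfolding t_def by (rule tail_weight_nonneg)
  have pred: "tail_weight J i (k - 1) = t + s" unfolding s_def t_def by (rule tail_weight_pred[OF k])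
  have w: "0 \<le> w" "w \<le> S" unfolding w_def using infsum_le[of "bonds i" i] by (auto intro: infsum_nonneg)
  have first: "w = t + s" if "k = 1"
    using pred that by (simp add: w_def tail_weight_def bonds_outside_0)
  define y where "y = (if k = 1 then 2 * w else t + s)"
  have lam: "lam \<beta> J i k = exp (- (\<beta> * t)) - exp (- (\<beta> * y))"
    using pred by (auto simp: lam_def y_def w_def t_def algebra_simps)
  have ty: "t \<le> y" and yt: "y - t \<le> s + (if k = 1 then S else 0)"
    using first w s0 t0 by (auto simp: y_def)
  have le: "\<beta> * t \<le> \<beta> * y" using ty \<beta> by simp
  then show "0 \<le> lam \<beta> J i k" by (simp add: lam)
  have "lam \<beta> J i k \<le> \<beta> * y - \<beta> * t"
    unfolding lam using \<beta> t0 le by (intro exp_diff_le) auto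
  also have "\<dots> = \<beta> * (y - t)" by (simp add: algebra_simps)
  also have "\<dots> \<le> \<beta> * (s + (if k = 1 then S else 0))" using yt \<beta> by (intro mult_left_mono) auto
  finally show "lam \<beta> J i k \<le> \<beta> * ((\<Sum>\<^sub>\<infinity>B\<in>shell i k. \<bar>J B\<bar>) + (if k = 1 then S else 0))"
    by (simp add: s_def)
qed

text \<open>
  Summing the bounds on \<open>lam\<close> leaves the shell sums, controlled by \<open>C\<close>, and the extra term at
  \<open>k = 1\<close>. In particular \<open>gam\<close> tends to one as \<open>\<beta>\<close> tends to zero.
\<close>
lemma gam_bounds:
  assumes \<beta>: "0 < \<beta>"
  shows "gam \<beta> J \<le> 1" "1 - \<beta> * (C + real (card (site_ball (0 :: 'd site) 1)) * S) \<le> gam \<beta> J"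
proof -
  let ?N = "real (card (site_ball (0 :: 'd site) 1))"
  let ?f = "\<lambda>i k. real (card (site_ball i k)) * lam \<beta> J i k"
  have nonneg: "0 \<le> infsum (?f i) {1..}" for i
    using lam_bounds(1)[OF \<beta>] by (intro infsum_nonneg mult_nonneg_nonneg) auto
  have upper: "infsum (?f i) {1..} \<le> \<beta> * (C + ?N * S)" for i
  proof (rule nonneg_infsum_le(2))
    show "0 \<le> ?f i k" if "k \<in> {1..}" for k using that lam_bounds(1)[OF \<beta>] by simp
    fix K :: "nat set" assume K: "finite K" "K \<subseteq> {1..}"
    let ?s = "\<lambda>k. \<Sum>\<^sub>\<infinity>B\<in>shell i k. \<bar>J B\<bar>"
    have "sum (?f i) K \<le> (\<Sum>k\<in>K. real (card (site_ball i k)) * (\<beta> * (?s k + (if k = 1 then S else 0))))"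
      using K(2) by (intro sum_mono mult_left_mono lam_bounds(2)[OF \<beta>]) auto
    also have "\<dots> = \<beta> * ((\<Sum>k\<in>K. real (card (site_ball i k)) * ?s k)
        + (\<Sum>k\<in>K. if k = 1 then real (card (site_ball i 1)) * S else 0))"
      unfolding sum_distrib_left sum.distrib[symmetric]
      by (intro sum.cong) (auto simp: algebra_simps)
    also have "\<dots> \<le> \<beta> * (C + ?N * S)"
    proof (intro mult_left_mono add_mono)
      show "(\<Sum>k\<in>K. if k = 1 then real (card (site_ball i 1)) * S else 0) \<le> ?N * S"
        using S_nonneg K(1) by (simp add: card_site_ball_translate[of i "Suc 0"])
    qed (use \<beta> shells_le[OF K, of i] in simp_all)
    finally show "sum (?f i) K \<le> \<beta> * (C + ?N * S)" .
  qed
  have "0 \<le> (SUP i. infsum (?f i) {1..})"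
    using upper nonneg
    by (intro cSUP_upper2[where x = 0] bdd_aboveI[where M = "\<beta> * (C + ?N * S)"]) auto
  then show "gam \<beta> J \<le> 1" by (simp add: gam_def)
  have "(SUP i. infsum (?f i) {1..}) \<le> \<beta> * (C + ?N * S)"
    using upper by (intro cSUP_least) auto
  then show "1 - \<beta> * (C + ?N * S) \<le> gam \<beta> J" by (simp add: gam_def)
qed

text \<open>
  A bond contributes to the difference of the fields only if the configurations disagree somewhere
  on it. Counting all of its disagreeing sites instead of detecting one of them gives an expression
  that is linear in the disagreements and hence easy to average.
\<close>
lemma field_from_diff:
  assumes \<sigma>: "\<sigma> \<in> space config_space" and \<tau>: "\<tau> \<in> space config_space"
  shows "(\<lambda>B. \<bar>J B\<bar> * real (card {j \<in> B. \<sigma> j \<noteq> \<tau> j})) summable_on bonds i"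
    and "\<bar>field_from J (bonds i) \<sigma> - field_from J (bonds i) \<tau>\<bar>
           \<le> 2 * (\<Sum>\<^sub>\<infinity>B\<in>bonds i. \<bar>J B\<bar> * real (card {j \<in> B. \<sigma> j \<noteq> \<tau> j}))"
proof -
  have fin: "finite B" if "B \<in> bonds i" for B using that by (simp add: bonds_def)
  let ?D = "\<lambda>B. \<bar>J B\<bar> * real (card {j \<in> B. \<sigma> j \<noteq> \<tau> j})"
  show D: "?D summable_on bonds i"
  proof (rule nonneg_infsum_le(1))
    fix F assume F: "finite F" "F \<subseteq> bonds i"
    have "sum ?D F \<le> (\<Sum>B\<in>F. \<bar>J B\<bar> * real (card B))"
      using F fin by (intro sum_mono mult_left_mono) (auto intro: card_mono)
    then show "sum ?D F \<le> C" using size_weighted_sum_le[OF F] by simp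
  qed simp
  have s: "(\<lambda>B. J B * chi B \<rho>) summable_on bonds i" if "\<rho> \<in> space config_space" for \<rho>
    using summable_chi[OF summable[OF order_refl] that] by (rule abs_summable_summable)
  have le: "norm (J B * chi B \<sigma> - J B * chi B \<tau>) \<le> 2 * ?D B" if "B \<in> bonds i" for B
  proof -
    have "norm (J B * chi B \<sigma> - J B * chi B \<tau>) = \<bar>J B\<bar> * \<bar>chi B \<sigma> - chi B \<tau>\<bar>"
      unfolding right_diff_distrib[symmetric] real_norm_def by (rule abs_mult)
    also have "\<dots> \<le> \<bar>J B\<bar> * (2 * real (card {j \<in> B. \<sigma> j \<noteq> \<tau> j}))"
      using chi_diff[OF fin[OF that] \<sigma> \<tau>] by (rule mult_left_mono) simp
    finally show ?thesis by simp
  qed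
  have D2: "(\<lambda>B. 2 * ?D B) summable_on bonds i" using D by (rule summable_on_cmult_right)
  then have abs: "(\<lambda>B. norm (J B * chi B \<sigma> - J B * chi B \<tau>)) summable_on bonds i"
    by (rule summable_on_comparison_test) (use le in simp_all)
  have "field_from J (bonds i) \<sigma> - field_from J (bonds i) \<tau> =
      (\<Sum>\<^sub>\<infinity>B\<in>bonds i. J B * chi B \<sigma> - J B * chi B \<tau>)"
    unfolding field_from_def using infsum_add[OF abs_summable_summable[OF abs] s[OF \<tau>]] by simp
  also have "norm \<dots> \<le> (\<Sum>\<^sub>\<infinity>B\<in>bonds i. norm (J B * chi B \<sigma> - J B * chi B \<tau>))"
    by (rule norm_infsum_bound[OF abs])
  also have "\<dots> \<le> (\<Sum>\<^sub>\<infinity>B\<in>bonds i. 2 * ?D B)"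
    by (rule infsum_mono[OF abs D2 le])
  also have "\<dots> = 2 * (\<Sum>\<^sub>\<infinity>B\<in>bonds i. ?D B)" by (rule infsum_cmult_right')
  finally show "\<bar>field_from J (bonds i) \<sigma> - field_from J (bonds i) \<tau>\<bar> \<le> 2 * (\<Sum>\<^sub>\<infinity>B\<in>bonds i. ?D B)"
    by simp
qed

lemma field_from_truncate:
  assumes \<sigma>: "\<sigma> \<in> space config_space"
  shows "\<bar>field_from J (bonds i) \<sigma> - field_from J (bonds_inside i L) \<sigma>\<bar> \<le> tail_weight J i L"
proof -
  have s: "(\<lambda>B. norm (J B * chi B \<sigma>)) summable_on A" if "A \<subseteq> bonds i" for A
    by (rule summable_chi[OF summable[OF that] \<sigma>])
  have split: "bonds i = bonds_inside i L \<union> bonds_outside i L" "bonds_inside i L \<inter> bonds_outside i L = {}"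
    by (auto simp: bonds_inside_def bonds_outside_def)
  have "field_from J (bonds i) \<sigma> = field_from J (bonds_inside i L) \<sigma> + field_from J (bonds_outside i L) \<sigma>"
    unfolding field_from_def
    by (subst split(1), rule infsum_Un_disjoint[OF abs_summable_summable[OF s[OF bonds_inside_subset]]
          abs_summable_summable[OF s[OF bonds_outside_subset]] split(2)])
  moreover have "\<bar>field_from J (bonds_outside i L) \<sigma>\<bar> \<le> tail_weight J i L"
    using norm_infsum_bound[OF s[OF bonds_outside_subset]]
    by (simp add: field_from_def tail_weight_def abs_mult abs_chi[OF \<sigma>])
  ultimately show ?thesis by simp
qed

lemma heat_bath_diff:
  assumes \<beta>: "0 < \<beta>" and \<sigma>: "\<sigma> \<in> space config_space" and \<tau>: "\<tau> \<in> space config_space"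
  shows "\<bar>heat_bath \<beta> J bonds i \<sigma> - heat_bath \<beta> J (\<lambda>i. bonds_inside i L) i \<tau>\<bar>
     \<le> \<beta> * (\<Sum>\<^sub>\<infinity>B\<in>bonds i. \<bar>J B\<bar> * real (card {j \<in> B. \<sigma> j \<noteq> \<tau> j})) + \<beta> * tail_weight J i L / 2"
    (is "_ \<le> \<beta> * ?D + _")
proof -
  let ?h = "field_from J (bonds i) \<sigma>" and ?h' = "field_from J (bonds_inside i L) \<tau>"
  have "\<bar>?h - ?h'\<bar> \<le> 2 * ?D + tail_weight J i L"
    using field_from_diff(2)[OF \<sigma> \<tau>, of i] field_from_truncate[OF \<tau>, of i L] by linarith
  then have "(\<beta> / 2) * \<bar>?h - ?h'\<bar> \<le> (\<beta> / 2) * (2 * ?D + tail_weight J i L)"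
    using \<beta> by (intro mult_left_mono) auto
  moreover have "\<bar>2 * \<beta> * ?h - 2 * \<beta> * ?h'\<bar> / 4 = (\<beta> / 2) * \<bar>?h - ?h'\<bar>"
  proof -
    have "2 * \<beta> * ?h - 2 * \<beta> * ?h' = (2 * \<beta>) * (?h - ?h')" by (rule right_diff_distrib[symmetric])
    then show ?thesis using \<beta> by (simp only: abs_mult)
  qed
  ultimately show ?thesis
    using logistic_lipschitz[of "2 * \<beta> * ?h" "2 * \<beta> * ?h'"]
    by (simp add: heat_bath_def algebra_simps)
qed

text \<open>
  Exchanging the mean with the sum over bonds, each bond \<open>B\<close> contributes \<open>\<bar>J B\<bar>\<close> times the sum of the
  disagreement probabilities of its sites, which is at most \<open>\<bar>J B\<bar> \<bar>B\<bar> r\<close>.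
\<close>
lemma nn_integral_disagreeing_bonds:
  assumes Q: "Q \<in> couplings \<mu> \<nu>" and r: "\<forall>j. disagreement Q j \<le> r"
  shows "(\<lambda>\<omega>. ennreal (\<Sum>\<^sub>\<infinity>B\<in>bonds i. \<bar>J B\<bar> * real (card {j \<in> B. fst \<omega> j \<noteq> snd \<omega> j})))
            \<in> borel_measurable Q" (is ?measurable)
    and "(\<integral>\<^sup>+\<omega>. ennreal (\<Sum>\<^sub>\<infinity>B\<in>bonds i. \<bar>J B\<bar> * real (card {j \<in> B. fst \<omega> j \<noteq> snd \<omega> j})) \<partial>Q)
           \<le> ennreal (C * r)" (is ?bound)
proof -
  note Q' = couplingsD[OF Q]
  note [measurable_cong] = Q'(2)
  interpret Q: prob_space Q by (rule Q'(1))
  interpret K: sigma_finite_measure "count_space (bonds i)"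
    by (rule sigma_finite_measure_count_space_countable[OF countable_bonds])
  interpret P: pair_sigma_finite Q "count_space (bonds i)" ..
  have r0: "0 \<le> r" using r order_trans[OF measure_nonneg] unfolding disagreement_def by blast
  let ?D = "\<lambda>\<omega> B. \<bar>J B\<bar> * real (card {j \<in> B. fst \<omega> j \<noteq> snd \<omega> j})"
  have fin: "finite B" if "B \<in> bonds i" for B using that by (simp add: bonds_def)
  have D_sum: "ennreal (?D \<omega> B) = (\<Sum>j\<in>B. ennreal \<bar>J B\<bar> * indicator {\<omega> \<in> space Q. fst \<omega> j \<noteq> snd \<omega> j} \<omega>)"
    if \<omega>: "\<omega> \<in> space Q" and B: "B \<in> bonds i" for \<omega> B
  proof -
    have "{j \<in> B. fst \<omega> j \<noteq> snd \<omega> j} = B \<inter> {j. fst \<omega> j \<noteq> snd \<omega> j}" by auto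
    then have "real (card {j \<in> B. fst \<omega> j \<noteq> snd \<omega> j}) = (\<Sum>j\<in>B. indicator {j. fst \<omega> j \<noteq> snd \<omega> j} j)"
      using fin[OF B] by (simp add: indicator_def sum.If_cases)
    then have "?D \<omega> B = (\<Sum>j\<in>B. \<bar>J B\<bar> * indicator {\<omega> \<in> space Q. fst \<omega> j \<noteq> snd \<omega> j} \<omega>)"
      using \<omega> by (simp add: sum_distrib_left indicator_def)
    also have "ennreal \<dots> = (\<Sum>j\<in>B. ennreal (\<bar>J B\<bar> * indicator {\<omega> \<in> space Q. fst \<omega> j \<noteq> snd \<omega> j} \<omega>))"
      by (intro sum_ennreal[symmetric]) simp
    also have "\<dots> = (\<Sum>j\<in>B. ennreal \<bar>J B\<bar> * indicator {\<omega> \<in> space Q. fst \<omega> j \<noteq> snd \<omega> j} \<omega>)"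
      by (intro sum.cong) (auto simp: indicator_def)
    finally show ?thesis .
  qed
  have set: "{\<omega> \<in> space Q. fst \<omega> j \<noteq> snd \<omega> j} \<in> sets Q" for j
    unfolding Q'(2,3) by measurable
  have meas: "(\<lambda>\<omega>. ennreal (?D \<omega> B)) \<in> borel_measurable Q" if B: "B \<in> bonds i" for B
  proof -
    have "(\<lambda>\<omega>. \<Sum>j\<in>B. ennreal \<bar>J B\<bar> * indicator {\<omega> \<in> space Q. fst \<omega> j \<noteq> snd \<omega> j} \<omega>) \<in> borel_measurable Q"
      using set by (intro borel_measurable_sum borel_measurable_times_ennreal) auto
    then show ?thesis by (rule measurable_cong[THEN iffD2, rotated]) (rule D_sum[OF _ B])
  qed
  have meas2: "(\<lambda>(\<omega>, B). ennreal (?D \<omega> B)) \<in> borel_measurable (Q \<Otimes>\<^sub>M count_space (bonds i))"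
    unfolding case_prod_beta
    by (rule measurable_compose_countable'[where g = snd and I = "bonds i"])
       (erule measurable_compose[OF measurable_fst meas], rule measurable_snd, rule countable_bonds)
  have one: "(\<integral>\<^sup>+\<omega>. ennreal (?D \<omega> B) \<partial>Q) \<le> ennreal (\<bar>J B\<bar> * real (card B) * r)" if B: "B \<in> bonds i" for B
  proof -
    have "(\<integral>\<^sup>+\<omega>. ennreal (?D \<omega> B) \<partial>Q) =
        (\<integral>\<^sup>+\<omega>. (\<Sum>j\<in>B. ennreal \<bar>J B\<bar> * indicator {\<omega> \<in> space Q. fst \<omega> j \<noteq> snd \<omega> j} \<omega>) \<partial>Q)"
      by (rule nn_integral_cong) (rule D_sum[OF _ B])
    also have "\<dots> = (\<Sum>j\<in>B. ennreal \<bar>J B\<bar> * emeasure Q {\<omega> \<in> space Q. fst \<omega> j \<noteq> snd \<omega> j})"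
      using set by (subst nn_integral_sum) (auto simp: nn_integral_cmult_indicator)
    also have "\<dots> \<le> (\<Sum>j\<in>B. ennreal \<bar>J B\<bar> * ennreal r)"
      using r by (intro sum_mono mult_left_mono) (auto simp: Q.emeasure_eq_measure disagreement_def intro: ennreal_leI)
    also have "\<dots> = (\<Sum>j\<in>B. ennreal (\<bar>J B\<bar> * r))"
      using r0 by (simp add: ennreal_mult)
    also have "\<dots> = ennreal (\<Sum>j\<in>B. \<bar>J B\<bar> * r)"
      using r0 by (intro sum_ennreal) simp
    also have "(\<Sum>j\<in>B. \<bar>J B\<bar> * r) = \<bar>J B\<bar> * real (card B) * r" by simp
    finally show ?thesis .
  qed
  have sm: "(\<Sum>B\<in>F. \<bar>J B\<bar> * real (card B) * r) \<le> C * r" if "finite F" "F \<subseteq> bonds i" for F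
    using mult_right_mono[OF size_weighted_sum_le[OF that] r0] by (simp add: sum_distrib_right)
  have nn: "0 \<le> \<bar>J B\<bar> * real (card B) * r" for B using r0 by simp
  note total = nonneg_infsum_le[where A = "bonds i", OF nn sm]
  have as_integral: "ennreal (\<Sum>\<^sub>\<infinity>B\<in>bonds i. ?D \<omega> B) = (\<integral>\<^sup>+B. ennreal (?D \<omega> B) \<partial>count_space (bonds i))"
    if "\<omega> \<in> space Q" for \<omega>
  proof -
    from that have "fst \<omega> \<in> space config_space" "snd \<omega> \<in> space config_space"
      unfolding Q'(3) by (auto simp: space_pair_measure)
    then show ?thesis
      by (intro nn_integral_count_space_infsum[symmetric] field_from_diff(1)) auto
  qed
  have "(\<lambda>\<omega>. \<integral>\<^sup>+B. ennreal (?D \<omega> B) \<partial>count_space (bonds i)) \<in> borel_measurable Q"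
    using K.borel_measurable_nn_integral[OF meas2] by simp
  then show ?measurable
    by (rule measurable_cong[THEN iffD2, rotated]) (rule as_integral)
  have "(\<integral>\<^sup>+\<omega>. ennreal (\<Sum>\<^sub>\<infinity>B\<in>bonds i. ?D \<omega> B) \<partial>Q) = (\<integral>\<^sup>+\<omega>. \<integral>\<^sup>+B. ennreal (?D \<omega> B) \<partial>count_space (bonds i) \<partial>Q)"
    by (rule nn_integral_cong) (rule as_integral)
  also have "\<dots> = (\<integral>\<^sup>+B. \<integral>\<^sup>+\<omega>. ennreal (?D \<omega> B) \<partial>Q \<partial>count_space (bonds i))"
    by (rule P.Fubini'[OF meas2, symmetric])
  also have "\<dots> \<le> (\<integral>\<^sup>+B. ennreal (\<bar>J B\<bar> * real (card B) * r) \<partial>count_space (bonds i))"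
    using one by (intro nn_integral_mono) auto
  also have "\<dots> = ennreal (\<Sum>\<^sub>\<infinity>B\<in>bonds i. \<bar>J B\<bar> * real (card B) * r)"
    by (rule nn_integral_count_space_infsum[OF total(1) nn])
  also have "\<dots> \<le> ennreal (C * r)" using total(2) by (rule ennreal_leI)
  finally show ?bound .
qed

text \<open>
  The hypothesis of \<open>dbar_le_of_contraction\<close> for a Gibbs measure and a truncated one: the
  disagreements contribute the contraction factor \<open>\<beta> C\<close> and the truncation the constant \<open>b\<close>.
\<close>
lemma nn_integral_heat_bath_diff:
  assumes \<beta>: "0 < \<beta>" and Q: "Q \<in> couplings \<mu> \<nu>" and r: "\<forall>j. disagreement Q j \<le> r"
    and b: "\<beta> * tail_weight J i L / 2 \<le> b"
  shows "(\<integral>\<^sup>+\<omega>. ennreal \<bar>heat_bath \<beta> J bonds i ((fst \<omega>)(i := 1))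
            - heat_bath \<beta> J (\<lambda>i. bonds_inside i L) i ((snd \<omega>)(i := 1))\<bar> \<partial>Q) \<le> ennreal (\<beta> * C * r + b)"
proof -
  note Q' = couplingsD[OF Q]
  interpret Q: prob_space Q by (rule Q'(1))
  have r0: "0 \<le> r" using r order_trans[OF measure_nonneg] unfolding disagreement_def by blast
  have b0: "0 \<le> b" using b \<beta> tail_weight_nonneg[of i L] by (smt (verit) divide_nonneg_nonneg mult_nonneg_nonneg)
  let ?D = "\<lambda>\<omega>. \<Sum>\<^sub>\<infinity>B\<in>bonds i. \<bar>J B\<bar> * real (card {j \<in> B. fst \<omega> j \<noteq> snd \<omega> j})"
  have D0: "0 \<le> ?D \<omega>" for \<omega> by (rule infsum_nonneg) simp
  have "(\<integral>\<^sup>+\<omega>. ennreal \<bar>heat_bath \<beta> J bonds i ((fst \<omega>)(i := 1))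
            - heat_bath \<beta> J (\<lambda>i. bonds_inside i L) i ((snd \<omega>)(i := 1))\<bar> \<partial>Q)
      \<le> (\<integral>\<^sup>+\<omega>. ennreal (\<beta> * ?D \<omega> + b) \<partial>Q)"
  proof (rule nn_integral_mono, rule ennreal_leI)
    fix \<omega> assume "\<omega> \<in> space Q"
    then have \<omega>: "fst \<omega> \<in> space config_space" "snd \<omega> \<in> space config_space"
      unfolding Q'(3) by (auto simp: space_pair_measure)
    then have \<omega>': "(fst \<omega>)(i := 1) \<in> space config_space" "(snd \<omega>)(i := 1) \<in> space config_space"
      by (auto simp: space_config)
    let ?D' = "\<Sum>\<^sub>\<infinity>B\<in>bonds i. \<bar>J B\<bar> * real (card {j \<in> B. ((fst \<omega>)(i := 1)) j \<noteq> ((snd \<omega>)(i := 1)) j})"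
    have "?D' \<le> ?D \<omega>"
    proof (rule infsum_mono[OF field_from_diff(1)[OF \<omega>'] field_from_diff(1)[OF \<omega>]])
      fix B assume "B \<in> bonds i"
      then have "finite B" by (simp add: bonds_def)
      then show "\<bar>J B\<bar> * real (card {j \<in> B. ((fst \<omega>)(i := 1)) j \<noteq> ((snd \<omega>)(i := 1)) j})
          \<le> \<bar>J B\<bar> * real (card {j \<in> B. fst \<omega> j \<noteq> snd \<omega> j})"
        by (intro mult_left_mono of_nat_mono card_mono) (auto split: if_splits)
    qed
    then have "\<beta> * ?D' \<le> \<beta> * ?D \<omega>" using \<beta> by (intro mult_left_mono) auto
    then show "\<bar>heat_bath \<beta> J bonds i ((fst \<omega>)(i := 1))
            - heat_bath \<beta> J (\<lambda>i. bonds_inside i L) i ((snd \<omega>)(i := 1))\<bar> \<le> \<beta> * ?D \<omega> + b"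
      using heat_bath_diff[OF \<beta> \<omega>', of i L] b by linarith
  qed
  also have "\<dots> = (\<integral>\<^sup>+\<omega>. ennreal \<beta> * ennreal (?D \<omega>) + ennreal b \<partial>Q)"
  proof (rule nn_integral_cong)
    fix \<omega>
    have "0 \<le> \<beta> * ?D \<omega>" using \<beta> by (intro mult_nonneg_nonneg D0) simp
    then have "ennreal (\<beta> * ?D \<omega> + b) = ennreal (\<beta> * ?D \<omega>) + ennreal b"
      using b0 by (rule ennreal_plus)
    then show "ennreal (\<beta> * ?D \<omega> + b) = ennreal \<beta> * ennreal (?D \<omega>) + ennreal b"
      using \<beta> D0[of \<omega>] by (simp only: ennreal_mult less_imp_le)
  qed
  also have "\<dots> = ennreal \<beta> * (\<integral>\<^sup>+\<omega>. ennreal (?D \<omega>) \<partial>Q) + ennreal b"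
    using nn_integral_disagreeing_bonds(1)[OF Q r, of i]
    by (simp add: nn_integral_add nn_integral_cmult Q.emeasure_space_1)
  also have "\<dots> \<le> ennreal \<beta> * ennreal (C * r) + ennreal b"
    by (intro add_right_mono mult_left_mono nn_integral_disagreeing_bonds(2)[OF Q r]) simp
  also have "\<dots> = ennreal (\<beta> * C * r + b)"
    using \<beta> b0 r0 C_nonneg by (simp add: ennreal_mult mult.assoc)
  finally show ?thesis .
qed

end

section \<open>Truncating the interaction\<close>
theorem theorem4:
  fixes J :: "(int ^ 'd::finite) set \<Rightarrow> real"
  assumes "interaction J"
    and "fast_decay J"
  shows "\<exists>\<beta>\<^sub>c>0. \<forall>\<beta>. 0 < \<beta> \<and> \<beta> < \<beta>\<^sub>c \<longrightarrow>
           (\<forall>L\<ge>1. \<forall>\<mu> \<mu>\<^sub>L. gibbs_measure \<beta> J \<mu> \<and> truncated_gibbs_measure \<beta> J L \<mu>\<^sub>L \<longrightarrow>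
              dbar \<mu> \<mu>\<^sub>L \<le> 1 / gam \<beta> J * (SUP i. 1 - exp (- \<beta> * tail_weight J i L)))"
proof -
  obtain S C where "decaying_interaction J S C"
    by (rule decaying_interactionI[OF assms])
  then interpret decaying_interaction J S C .
  let ?N = "real (card (site_ball (0 :: 'd site) 1))"
  \<comment> \<open>Below \<open>1 / (3 M)\<close> all of \<open>\<beta> C\<close>, \<open>\<beta> t \<le> \<beta> S\<close> and \<open>1 - gam \<beta> J\<close> are at most \<open>1/3\<close>.\<close>
  define M where "M = C + ?N * S + S + 1"
  have M: "0 < M" "C \<le> M" "S \<le> M" "C + ?N * S \<le> M"
    using C_nonneg S_nonneg by (auto simp: M_def intro: add_nonneg_pos)
  have main: "dbar \<mu> \<mu>\<^sub>L \<le> 1 / gam \<beta> J * (SUP i. 1 - exp (- \<beta> * tail_weight J i L))"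
    if \<beta>: "0 < \<beta>" "\<beta> < 1 / (3 * M)" and \<mu>: "gibbs_measure \<beta> J \<mu>"
      and \<mu>\<^sub>L: "truncated_gibbs_measure \<beta> J L \<mu>\<^sub>L" for \<beta> L \<mu> \<mu>\<^sub>L
  proof -
    have \<beta>M: "\<beta> * M \<le> 1 / 3" using \<beta>(2) M(1) by (simp add: field_simps)
    have small: "\<beta> * x \<le> 1 / 3" if "x \<le> M" for x
      using mult_left_mono[OF that, of \<beta>] \<beta>(1) \<beta>M by linarith
    define b where "b = (SUP i. 1 - exp (- \<beta> * tail_weight J i L))"
    have bdd: "bdd_above (range (\<lambda>i. 1 - exp (- \<beta> * tail_weight J i L)))"
      by (rule bdd_aboveI[where M = 1]) auto
    have le_b: "1 - exp (- \<beta> * tail_weight J i L) \<le> b" for i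
      unfolding b_def by (rule cSUP_upper[OF UNIV_I bdd])
    have half: "\<beta> * tail_weight J i L / 2 \<le> 2 / 3 * b" for i
    proof -
      have "\<beta> * tail_weight J i L / 2 \<le> 2 / 3 * (1 - exp (- (\<beta> * tail_weight J i L)))"
        using \<beta>(1) tail_weight_nonneg[of i L] small[OF order_trans[OF tail_weight_le M(3)], of i L]
        by (intro half_le_two_thirds_exp) auto
      then show ?thesis using le_b[of i] by simp
    qed
    have b0: "0 \<le> b"
      using le_b[of 0] \<beta>(1) tail_weight_nonneg[of 0 L] by (auto intro: order_trans[rotated])
    have c: "0 \<le> \<beta> * C" "\<beta> * C \<le> 1 / 3" using \<beta>(1) C_nonneg small[OF M(2)] by auto
    have p: "single_site_spec (heat_bath \<beta> J bonds)"
      "single_site_spec (heat_bath \<beta> J (\<lambda>i. bonds_inside i L))"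
      by (intro single_site_spec_heat_bath summable[OF order_refl]; simp add: bonds_inside_subset)+
    have "dbar \<mu> \<mu>\<^sub>L \<le> (2 / 3 * b) / (1 - \<beta> * C)"
      by (rule dbar_le_of_contraction[OF p(1) \<mu>[unfolded gibbs_measure_heat_bath]
            p(2) \<mu>\<^sub>L[unfolded gibbs_measure_heat_bath]])
         (use nn_integral_heat_bath_diff[OF \<beta>(1) _ _ half] c b0 in auto)
    also have "\<dots> \<le> b"
    proof -
      have "2 / 3 * b \<le> (1 - \<beta> * C) * b" using c b0 by (intro mult_right_mono) auto
      then show ?thesis using c by (simp add: field_simps)
    qed
    also have "\<dots> \<le> 1 / gam \<beta> J * b"
    proof -
      have "0 < gam \<beta> J" using gam_bounds(2)[OF \<beta>(1)] small[OF M(4)] by linarith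
      then have "1 \<le> 1 / gam \<beta> J" using gam_bounds(1)[OF \<beta>(1)] by simp
      then show ?thesis using mult_right_mono[OF _ b0, of 1 "1 / gam \<beta> J"] by simp
    qed
    finally show ?thesis unfolding b_def .
  qed
  show ?thesis
  proof (intro exI[of _ "1 / (3 * M)"] conjI allI impI)
    show "0 < 1 / (3 * M)" using M(1) by simp
  qed (use main in auto)
qed

end
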